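(* Let $\Omega\subset\mathbb{R}^n$ be an open and bounded set and let $\alpha\in\mathcal{A}^{\log}(\Omega)$. Let $a^{ij},b^i,c\in C^{\alpha(\cdot)}(\bar\Omega)$ ($i,j=1,\dots,n$), let $f\in C^{\alpha(\cdot)}(\bar\Omega)$, and suppose that $u\in C^{2,\alpha(\cdot)}(\bar\Omega)$ satisfies $$Lu=a^{ij}D_{ij}u+b^iD_iu+cu=f\quad\text{in }\Omega.$$ Assume that there are positive constants $\lambda,\Lambda$ such that $$a^{ij}(x)\zeta^i\zeta^j\ge\lambda|\zeta|^2\quad\text{for all }x\in\Omega,\ \zeta\in\mathbb{R}^n,$$ $$|a^{ij}|^{(0)}_{0,\alpha(\cdot),\Omega},\ |b^i|^{(1)}_{0,\alpha(\cdot),\Omega},\ |c|^{(2)}_{0,\alpha(\cdot),\Omega}\le\Lambda\quad\text{for all }i,j.$$ Then $$|u|^*_{2,\alpha(\cdot),\Omega}\le C\left(|u|_{0,\Omega}+|f|^{(2)}_{0,\alpha(\cdot),\Omega}\right),$$ where the constant $C$ depends only on $\mathrm{diam}(\Omega),n,\alpha^-,\alpha^+,c_{\log}(\alpha),\Lambda,\lambda$.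
   Context: Summation over repeated indices is understood. For $\alpha:\Omega\to(0,1]$ put $\alpha^-=\inf_\Omega\alpha$, $\alpha^+=\sup_\Omega\alpha$. The exponent $\alpha$ is log-Hölder continuous in $\Omega$ if there is $M>0$ with $\big|\ln|x-y|\big|\,|\alpha(x)-\alpha(y)|\le M$ for all $x\ne y$ in $\Omega$; the smallest such $M$ is $c_{\log}(\alpha)$. $\mathcal{A}^{\log}(\Omega)$ is the set of log-Hölder continuous $\alpha$ in $\Omega$ with $0<\alpha^-\le\alpha^+<1$. $C^k(\Omega)$ is the set of functions on $\Omega$ all of whose derivatives up to order $k$ are bounded and continuous; $C^k(\bar\Omega)$ is the set of $u\in C^k(\Omega)$ whose derivatives up to order $k$ extend continuously to $\bar\Omega$. Put $|u|_{k,\Omega}=\sum_{j=0}^k\sup_{x\in\Omega,|\beta|=j}|D^\beta u(x)|$ (so $|u|_{0,\Omega}=\sup_\Omega|u|$) and $[u]_{k,\alpha(\cdot),\Omega}=\sup_{x\ne y\in\Omega,|\beta|=k}\frac{|D^\beta u(x)-D^\beta u(y)|}{|x-y|^{\alpha(x)}}$. $C^{k,\alpha(\cdot)}(\bar\Omega)$ is the set of $u\in C^k(\bar\Omega)$ with $|u|_{k,\Omega}+[u]_{k,\alpha(\cdot),\Omega}<\infty$, and $C^{\alpha(\cdot)}(\bar\Omega)=C^{0,\alpha(\cdot)}(\bar\Omega)$. Let $d_x=\mathrm{dist}(x,\partial\Omega)$, $d_{x,y}=\min\{d_x,d_y\}$. Define $[u]^*_{k,\Omega}=\sup_{x\in\Omega,|\beta|=k}d_x^k|D^\beta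 u(x)|$, $[u]^*_{k,\alpha(\cdot),\Omega}=\sup_{x\ne y\in\Omega,|\beta|=k}d_{x,y}^{k+\alpha(x)}\frac{|D^\beta u(x)-D^\beta u(y)|}{|x-y|^{\alpha(x)}}$, $|u|^*_{k,\alpha(\cdot),\Omega}=\sum_{j=0}^k[u]^*_{j,\Omega}+[u]^*_{k,\alpha(\cdot),\Omega}$, and for $s\ge0$ $|f|^{(s)}_{0,\alpha(\cdot),\Omega}=\sup_{x\in\Omega}d_x^s|f(x)|+\sup_{x\ne y\in\Omega}d_{x,y}^{s+\alpha(x)}\frac{|f(x)-f(y)|}{|x-y|^{\alpha(x)}}$. *)

theory Defs
  imports "HOL-Analysis.Analysis"
begin

text \<open>
  Functions on a set \<open>\<Omega>\<close> are represented by total functions on \<open>real^'n\<close>; everything below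
  depends only on their values on \<open>\<Omega>\<close> when \<open>\<Omega>\<close> is open. Norms and seminorms take values
  in \<^typ>\<open>ennreal\<close>, so every supremum is the true one, possibly infinite, and a supremum
  over an empty set is 0.
\<close>

definition exp_inf :: "(real^'n) set \<Rightarrow> (real^'n \<Rightarrow> real) \<Rightarrow> real" where
  "exp_inf \<Omega> \<alpha> = (INF x\<in>\<Omega>. \<alpha> x)"

definition exp_sup :: "(real^'n) set \<Rightarrow> (real^'n \<Rightarrow> real) \<Rightarrow> real" where
  "exp_sup \<Omega> \<alpha> = (SUP x\<in>\<Omega>. \<alpha> x)"

definition log_holder_bound :: "(real^'n) set \<Rightarrow> (real^'n \<Rightarrow> real) \<Rightarrow> real \<Rightarrow> bool" where
  "log_holder_bound \<Omega> \<alpha> M \<longleftrightarrow>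
     M > 0 \<and> (\<forall>x\<in>\<Omega>. \<forall>y\<in>\<Omega>. x \<noteq> y \<longrightarrow> \<bar>ln (norm (x - y))\<bar> * \<bar>\<alpha> x - \<alpha> y\<bar> \<le> M)"

text \<open>
  An infimum, since the admissible constants are required to be positive and so need not have a
  least element: for a constant exponent the value is 0, which is not attained.
\<close>

definition c_log :: "(real^'n) set \<Rightarrow> (real^'n \<Rightarrow> real) \<Rightarrow> real" where
  "c_log \<Omega> \<alpha> = Inf {M. log_holder_bound \<Omega> \<alpha> M}"

definition A_log :: "(real^'n) set \<Rightarrow> (real^'n \<Rightarrow> real) set" where
  "A_log \<Omega> = {\<alpha>. (\<forall>x\<in>\<Omega>. 0 < \<alpha> x \<and> \<alpha> x \<le> 1) \<and> (\<exists>M. log_holder_bound \<Omega> \<alpha> M) \<and>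
                  0 < exp_inf \<Omega> \<alpha> \<and> exp_inf \<Omega> \<alpha> \<le> exp_sup \<Omega> \<alpha> \<and> exp_sup \<Omega> \<alpha> < 1}"

definition partial_deriv :: "'n \<Rightarrow> (real^'n \<Rightarrow> real) \<Rightarrow> real^'n \<Rightarrow> real" where
  "partial_deriv i u x = deriv (\<lambda>t. u (x + t *\<^sub>R axis i 1)) 0"

definition has_partial :: "'n \<Rightarrow> (real^'n \<Rightarrow> real) \<Rightarrow> real^'n \<Rightarrow> bool" where
  "has_partial i u x \<longleftrightarrow> (\<lambda>t. u (x + t *\<^sub>R axis i 1)) field_differentiable (at 0)"

text \<open>
  A derivative of order \<open>k\<close> is indexed by the list of the \<open>k\<close> directions in which one
  differentiates: \<open>D [i, j] u = D\<^sub>i (D\<^sub>j u)\<close>. For functions of class \<open>C\<^sup>k\<close> the order of the list is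
  immaterial, so the lists of length \<open>k\<close> give the same derivatives as the multi-indices
  of order \<open>k\<close>.
\<close>

definition D :: "'n list \<Rightarrow> (real^'n \<Rightarrow> real) \<Rightarrow> real^'n \<Rightarrow> real" where
  "D \<beta> u = foldr partial_deriv \<beta> u"

definition C_open :: "nat \<Rightarrow> (real^'n) set \<Rightarrow> (real^'n \<Rightarrow> real) set" where
  "C_open k \<Omega> = {u.
     (\<forall>\<beta> i. length \<beta> < k \<longrightarrow> (\<forall>x\<in>\<Omega>. has_partial i (D \<beta> u) x)) \<and>
     (\<forall>\<beta>. length \<beta> \<le> k \<longrightarrow> continuous_on \<Omega> (D \<beta> u) \<and> bounded (D \<beta> u ` \<Omega>))}"

definition C_closure :: "nat \<Rightarrow> (real^'n) set \<Rightarrow> (real^'n \<Rightarrow> real) set" where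
  "C_closure k \<Omega> = {u \<in> C_open k \<Omega>.
     \<forall>\<beta>. length \<beta> \<le> k \<longrightarrow>
       (\<exists>g. continuous_on (closure \<Omega>) g \<and> (\<forall>x\<in>\<Omega>. g x = D \<beta> u x))}"

definition C_norm :: "nat \<Rightarrow> (real^'n) set \<Rightarrow> (real^'n \<Rightarrow> real) \<Rightarrow> ennreal" where
  "C_norm k \<Omega> u = (\<Sum>j\<le>k. SUP x\<in>\<Omega>. SUP \<beta>\<in>{\<beta>. length \<beta> = j}. ennreal \<bar>D \<beta> u x\<bar>)"

definition holder_seminorm ::
    "nat \<Rightarrow> (real^'n \<Rightarrow> real) \<Rightarrow> (real^'n) set \<Rightarrow> (real^'n \<Rightarrow> real) \<Rightarrow> ennreal" where
  "holder_seminorm k \<alpha> \<Omega> u =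
     (SUP x\<in>\<Omega>. SUP y\<in>\<Omega> - {x}. SUP \<beta>\<in>{\<beta>. length \<beta> = k}.
        ennreal (\<bar>D \<beta> u x - D \<beta> u y\<bar> / norm (x - y) powr \<alpha> x))"

definition C_holder :: "nat \<Rightarrow> (real^'n \<Rightarrow> real) \<Rightarrow> (real^'n) set \<Rightarrow> (real^'n \<Rightarrow> real) set" where
  "C_holder k \<alpha> \<Omega> = {u \<in> C_closure k \<Omega>. C_norm k \<Omega> u + holder_seminorm k \<alpha> \<Omega> u < \<infinity>}"

definition bdist :: "(real^'n) set \<Rightarrow> real^'n \<Rightarrow> real" where
  "bdist \<Omega> x = infdist x (frontier \<Omega>)"

definition bdist2 :: "(real^'n) set \<Rightarrow> real^'n \<Rightarrow> real^'n \<Rightarrow> real" where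
  "bdist2 \<Omega> x y = min (bdist \<Omega> x) (bdist \<Omega> y)"

definition int_seminorm :: "nat \<Rightarrow> (real^'n) set \<Rightarrow> (real^'n \<Rightarrow> real) \<Rightarrow> ennreal" where
  "int_seminorm k \<Omega> u =
     (SUP x\<in>\<Omega>. SUP \<beta>\<in>{\<beta>. length \<beta> = k}. ennreal (bdist \<Omega> x ^ k * \<bar>D \<beta> u x\<bar>))"

definition int_holder_seminorm ::
    "nat \<Rightarrow> (real^'n \<Rightarrow> real) \<Rightarrow> (real^'n) set \<Rightarrow> (real^'n \<Rightarrow> real) \<Rightarrow> ennreal" where
  "int_holder_seminorm k \<alpha> \<Omega> u =
     (SUP x\<in>\<Omega>. SUP y\<in>\<Omega> - {x}. SUP \<beta>\<in>{\<beta>. length \<beta> = k}.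
        ennreal (bdist2 \<Omega> x y powr (real k + \<alpha> x) *
                 (\<bar>D \<beta> u x - D \<beta> u y\<bar> / norm (x - y) powr \<alpha> x)))"

definition int_holder_norm ::
    "nat \<Rightarrow> (real^'n \<Rightarrow> real) \<Rightarrow> (real^'n) set \<Rightarrow> (real^'n \<Rightarrow> real) \<Rightarrow> ennreal" where
  "int_holder_norm k \<alpha> \<Omega> u = (\<Sum>j\<le>k. int_seminorm j \<Omega> u) + int_holder_seminorm k \<alpha> \<Omega> u"

text \<open>
  The real power \<open>powr\<close> agrees with the usual one here, also for \<open>s = 0\<close>: for a bounded open
  \<open>\<Omega>\<close> the distance to the boundary is positive at every point of \<open>\<Omega>\<close>.
\<close>

definition weighted_norm ::
    "real \<Rightarrow> (real^'n \<Rightarrow> real) \<Rightarrow> (real^'n) set \<Rightarrow> (real^'n \<Rightarrow> real) \<Rightarrow> ennreal" where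
  "weighted_norm s \<alpha> \<Omega> f =
     (SUP x\<in>\<Omega>. ennreal (bdist \<Omega> x powr s * \<bar>f x\<bar>)) +
     (SUP x\<in>\<Omega>. SUP y\<in>\<Omega> - {x}.
        ennreal (bdist2 \<Omega> x y powr (s + \<alpha> x) * (\<bar>f x - f y\<bar> / norm (x - y) powr \<alpha> x)))"

definition elliptic_op ::
    "('n \<Rightarrow> 'n \<Rightarrow> real^'n \<Rightarrow> real) \<Rightarrow> ('n \<Rightarrow> real^'n \<Rightarrow> real) \<Rightarrow> (real^'n \<Rightarrow> real) \<Rightarrow>
     (real^'n \<Rightarrow> real) \<Rightarrow> real^'n \<Rightarrow> real" where
  "elliptic_op a b c u x =
     (\<Sum>i\<in>UNIV. \<Sum>j\<in>UNIV. a i j x * D [i, j] u x) + (\<Sum>i\<in>UNIV. b i x * D [i] u x) + c x * u x"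

end

theory Submission
  imports Defs
begin

text \<open>
  Freeze the leading coefficients at \<open>x\<close>. For a constant matrix \<open>A\<close>, comparing
  \<open>w(p + t e) - w(p - t e)\<close> with a quadratic barrier in the \<open>n + 1\<close> variables \<open>(p, t)\<close>, the maximum
  principle bounds the difference of \<open>w\<close> over a segment of length \<open>r\<close> by a multiple of
  \<open>(r / \<rho>) (sup |w| + \<rho>\<^sup>2 sup |A \<bullet> D\<^sup>2 w|)\<close>, the suprema being over a ball of radius \<open>\<rho>\<close>.
  Apply this to \<open>w = \<Delta>\<^sub>i \<Delta>\<^sub>j u - s\<^sup>2 D\<^sub>i\<^sub>j u(x)\<close>, where the differences have step \<open>s = \<epsilon> r\<close> and
  \<open>r = |x - y|\<close>, \<open>\<rho> = N r / 4\<close>. Only oscillations from the centre \<open>x\<close> enter, so the exponent is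
  \<open>\<alpha>(x)\<close> on the whole ball. Since \<open>\<Delta>\<^sub>i \<Delta>\<^sub>j u\<close> is \<open>s\<^sup>2\<close> times a nearby value of \<open>D\<^sub>i\<^sub>j u\<close>, this bounds
  \<open>D\<^sub>i\<^sub>j u(x) - D\<^sub>i\<^sub>j u(y)\<close> by \<open>r powr \<alpha>(x)\<close> times a small multiple of the Hoelder seminorm \<open>S\<close> of
  \<open>D\<^sup>2 u\<close> (for \<open>N\<close> large and \<open>\<epsilon>\<close> small) plus a large multiple of the lower-order quantities, which
  are interpolated between \<open>S\<close> and \<open>sup |u|\<close>; so \<open>S\<close> can be absorbed. Log-Hoelder
  continuity serves only to compare the powers \<open>\<alpha>(x)\<close> and \<open>\<alpha>(y)\<close> of the step.
\<close>

section \<open>Matrices and the Hessian at a maximum\<close>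

definition outer :: "real^'n \<Rightarrow> real^'n \<Rightarrow> real^'n^'n" where
  "outer v w = (\<chi> i j. v $ i * w $ j)"

lemma outer_nth [simp]: "outer v w $ i $ j = v $ i * w $ j"
  by (simp add: outer_def)

lemma outer_mult_vec: "outer v w *v z = (w \<bullet> z) *\<^sub>R v"
  by (simp add: vec_eq_iff matrix_vector_mult_def inner_vec_def sum_distrib_left mult_ac)

lemma inner_outer: "A \<bullet> outer v w = v \<bullet> (A *v w)" for A :: "real^'n^'n"
  by (simp add: inner_vec_def matrix_vector_mult_def sum_distrib_left mult_ac)

lemma inner_mat_1: "A \<bullet> mat 1 = (\<Sum>i\<in>UNIV. A $ i $ i)" for A :: "real^'n^'n"
  by (simp add: inner_vec_def mat_def if_distrib if_distribR cong: if_cong)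

lemma symmetric_mat_self_adjoint:
  fixes B :: "real^'n^'n"
  assumes "\<And>i j. B $ i $ j = B $ j $ i"
  shows "x \<bullet> (B *v y) = y \<bullet> (B *v x)"
proof -
  have "transpose B = B"
    using assms by (simp add: transpose_def vec_eq_iff)
  then show ?thesis
    by (metis dot_lmul_matrix inner_commute vector_transpose_matrix)
qed

text \<open>Induction on a set \<open>I\<close> outside which the rows of \<open>B\<close> vanish.
  Eliminating one index writes \<open>B\<close> as a nonnegative multiple of
  \<open>outer v v\<close>, whose pairing with \<open>A\<close> is a value of the quadratic form of
  \<open>A\<close>, plus a matrix supported on fewer rows. \<open>A\<close> enters only through its
  quadratic form, as the coefficient matrix does in the ellipticity condition.\<close>

lemma psd_inner_nonneg_aux:
  fixes A B :: "real^'n^'n"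
  assumes A: "\<And>z. 0 \<le> z \<bullet> (A *v z)" and "finite I"
    and "\<And>i j. B $ i $ j = B $ j $ i" and "\<And>z. 0 \<le> z \<bullet> (B *v z)"
    and "\<And>i j. i \<notin> I \<Longrightarrow> B $ i $ j = 0"
  shows "0 \<le> A \<bullet> B"
  using assms(2-)
proof (induction I arbitrary: B rule: finite_induct)
  case empty
  then have "B = 0" by (simp add: vec_eq_iff)
  then show ?case by simp
next
  case (insert k I)
  note sym = symmetric_mat_self_adjoint[OF insert.prems(1)]
  define v where "v = B *v axis k 1"
  define \<beta> where "\<beta> = B $ k $ k"
  have v_nth: "v $ i = B $ i $ k" for i
    by (simp add: v_def matrix_vector_mult_basis column_def)
  have v_dot: "z \<bullet> v = axis k 1 \<bullet> (B *v z)" for z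
    unfolding v_def by (rule sym)
  have ek: "axis k 1 \<bullet> v = \<beta>"
    by (simp add: inner_axis' v_nth \<beta>_def)
  have quad: "(z + t *\<^sub>R axis k 1) \<bullet> (B *v (z + t *\<^sub>R axis k 1))
      = z \<bullet> (B *v z) + 2 * t * (z \<bullet> v) + t\<^sup>2 * \<beta>" for z t
    using v_dot[of z] ek
    by (simp add: matrix_vector_right_distrib matrix_vector_mult_scaleR inner_add_left
        inner_add_right v_def[symmetric] power2_eq_square algebra_simps)
  have \<beta>: "0 \<le> \<beta>"
    using insert.prems(2)[of "axis k 1"] ek by (simp add: v_def)
  show ?case
  proof (cases "\<beta> = 0")
    case True
    \<comment> \<open>With a vanishing diagonal entry the quadratic form along
      \<open>z + t *\<^sub>R axis k 1\<close> is affine in \<open>t\<close>. It is nonnegative for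
      all \<open>t\<close> only if its slope is zero; otherwise the \<open>t\<close> chosen below
      gives it the value \<open>- 1\<close>.\<close>
    have "B $ k $ j = 0" for j
    proof -
      define z :: "real^'n" where "z = axis j 1"
      have zv: "z \<bullet> v = B $ k $ j"
        using insert.prems(1)[of j k] by (simp add: z_def inner_axis' v_nth)
      have *: "0 \<le> z \<bullet> (B *v z) + 2 * t * (B $ k $ j)" for t
        using insert.prems(2)[of "z + t *\<^sub>R axis k 1"] quad[of z t] True zv by simp
      show ?thesis
      proof (rule ccontr)
        assume ne: "B $ k $ j \<noteq> 0"
        show False
          using *[of "- (z \<bullet> (B *v z) + 1) / (2 * (B $ k $ j))"] ne by (simp add: field_simps)
      qed
    qed
    then have "B $ i $ j = 0" if "i \<notin> I" for i j
      using insert.prems(3)[of i j] that by (cases "i = k") auto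
    then show ?thesis
      using insert.IH insert.prems by blast
  next
    case False
    with \<beta> have pos: "0 < \<beta>" by simp
    \<comment> \<open>Splitting off a rank-one term clears row and column \<open>k\<close> and, by completing the square, keeps
      \<open>B\<close> nonnegative; so no diagonalisation is needed.\<close>
    define B' where "B' = B - (1 / \<beta>) *\<^sub>R outer v v"
    have 1: "B' $ i $ j = B' $ j $ i" for i j
      using insert.prems(1)[of i j] by (simp add: B'_def mult_ac)
    have 2: "0 \<le> z \<bullet> (B' *v z)" for z
    proof -
      have "z \<bullet> (B' *v z) = z \<bullet> (B *v z) - (z \<bullet> v)\<^sup>2 / \<beta>"
        by (simp add: B'_def matrix_vector_mult_diff_rdistrib scaleR_matrix_vector_assoc[symmetric]
            outer_mult_vec inner_diff_right inner_commute power2_eq_square)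
      also have "\<dots> = (z + (- (z \<bullet> v) / \<beta>) *\<^sub>R axis k 1) \<bullet> (B *v (z + (- (z \<bullet> v) / \<beta>) *\<^sub>R axis k 1))"
        unfolding quad using pos by (simp add: field_simps power2_eq_square)
      also have "\<dots> \<ge> 0" by (rule insert.prems(2))
      finally show ?thesis .
    qed
    have 3: "B' $ i $ j = 0" if "i \<notin> I" for i j
    proof (cases "i = k")
      case True
      then show ?thesis
        using pos insert.prems(1)[of k j] by (simp add: B'_def v_nth \<beta>_def)
    next
      case False
      then show ?thesis
        using insert.prems(3)[of i] that by (simp add: B'_def v_nth)
    qed
    have "0 \<le> A \<bullet> B'"
      by (rule insert.IH) (use 1 2 3 in auto)
    moreover have "A \<bullet> B = A \<bullet> B' + (1 / \<beta>) * (v \<bullet> (A *v v))"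
      by (simp add: B'_def inner_diff_right inner_outer)
    ultimately show ?thesis
      using A[of v] pos by (simp add: zero_le_divide_iff)
  qed
qed

lemma psd_inner_nonneg:
  fixes A B :: "real^'n^'n"
  assumes "\<And>z. 0 \<le> z \<bullet> (A *v z)" "\<And>i j. B $ i $ j = B $ j $ i" "\<And>z. 0 \<le> z \<bullet> (B *v z)"
  shows "0 \<le> A \<bullet> B"
  by (rule psd_inner_nonneg_aux[of A UNIV B]) (use assms in auto)

section \<open>Twice differentiable functions at a maximum\<close>

lemma second_derivative_local_max:
  fixes g g' :: "real \<Rightarrow> real"
  assumes d: "0 < d"
    and g: "\<And>t. \<bar>t - t0\<bar> < d \<Longrightarrow> (g has_real_derivative g' t) (at t)"
    and g': "(g' has_real_derivative g'') (at t0)"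
    and max: "\<And>t. \<bar>t - t0\<bar> < d \<Longrightarrow> g t \<le> g t0"
  shows "g'' \<le> 0"
proof (rule ccontr)
  assume "\<not> g'' \<le> 0"
  then have pos: "0 < g''" by simp
  have z: "g' t0 = 0"
    by (rule DERIV_local_max[OF g[of t0] d]) (use d max in auto)
  obtain e where e: "0 < e" and inc: "\<And>h. 0 < h \<Longrightarrow> h < e \<Longrightarrow> g' t0 < g' (t0 + h)"
    using has_real_derivative_pos_inc_right[OF g' pos] by auto
  define h where "h = min d e / 2"
  have h: "0 < h" "h < d" "h < e"
    using d e by (auto simp: h_def min_def)
  obtain \<xi> where \<xi>: "t0 < \<xi>" "\<xi> < t0 + h" "g (t0 + h) - g t0 = (t0 + h - t0) * g' \<xi>"
    using MVT2[of t0 "t0 + h" g g'] g h by auto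
  have "0 < g' \<xi>"
    using inc[of "\<xi> - t0"] \<xi> h z by auto
  then have "g t0 < g (t0 + h)"
    using \<xi> h by (smt (verit) mult_pos_pos)
  then show False
    using max[of "t0 + h"] h by auto
qed

text \<open>Gradient and Hessian are explicit arguments, so that translates, differences and
  barriers carry theirs along. Symmetry of the Hessian is included because
  \<open>psd_inner_nonneg\<close> asks for it; continuity of \<open>H\<close> is not part of the
  notion.\<close>

definition C2_on :: "(real^'n) set \<Rightarrow> (real^'n \<Rightarrow> real) \<Rightarrow> (real^'n \<Rightarrow> real^'n) \<Rightarrow>
    (real^'n \<Rightarrow> real^'n^'n) \<Rightarrow> bool" where
  "C2_on S u G H \<longleftrightarrow> (\<forall>x\<in>S. (u has_derivative (\<lambda>h. G x \<bullet> h)) (at x) \<and>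
     (G has_derivative (\<lambda>h. H x *v h)) (at x) \<and> (\<forall>i j. H x $ i $ j = H x $ j $ i))"

lemma C2_on_subset: "C2_on T u G H \<Longrightarrow> S \<subseteq> T \<Longrightarrow> C2_on S u G H"
  by (auto simp: C2_on_def)

lemma C2_on_translate:
  assumes "C2_on T u G H" and T: "\<And>x. x \<in> S \<Longrightarrow> x + k \<in> T"
  shows "C2_on S (\<lambda>x. u (x + k)) (\<lambda>x. G (x + k)) (\<lambda>x. H (x + k))"
  unfolding C2_on_def
proof (intro ballI conjI allI)
  fix x assume x: "x \<in> S"
  have 1: "((\<lambda>x. x + k) has_derivative (\<lambda>h. h)) (at x)"
    by (auto intro!: derivative_eq_intros)
  show "((\<lambda>x. u (x + k)) has_derivative (\<lambda>h. G (x + k) \<bullet> h)) (at x)"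
    using has_derivative_compose[OF 1, of u "\<lambda>h. G (x + k) \<bullet> h"] assms(1) T[OF x]
    by (auto simp: C2_on_def)
  show "((\<lambda>x. G (x + k)) has_derivative (\<lambda>h. H (x + k) *v h)) (at x)"
    using has_derivative_compose[OF 1, of G "\<lambda>h. H (x + k) *v h"] assms(1) T[OF x]
    by (auto simp: C2_on_def)
  show "H (x + k) $ i $ j = H (x + k) $ j $ i" for i j
    using assms(1) T[OF x] unfolding C2_on_def by blast
qed

lemma C2_on_diff:
  assumes "C2_on S u G H" "C2_on S v G' H'"
  shows "C2_on S (\<lambda>x. u x - v x) (\<lambda>x. G x - G' x) (\<lambda>x. H x - H' x)"
  using assms unfolding C2_on_def
  by (auto intro!: derivative_eq_intros simp: inner_diff_left matrix_vector_mult_diff_rdistrib)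

lemma C2_on_const: "C2_on S (\<lambda>x. c) (\<lambda>x. 0) (\<lambda>x. 0)"
  by (auto simp: C2_on_def)

lemma C2_on_quadratic:
  "C2_on S (\<lambda>x. k * ((x - z) \<bullet> (x - z))) (\<lambda>x. (2 * k) *\<^sub>R (x - z)) (\<lambda>x. (2 * k) *\<^sub>R mat 1)"
  unfolding C2_on_def
proof (intro ballI conjI allI)
  fix x
  show "((\<lambda>x. k * ((x - z) \<bullet> (x - z))) has_derivative (\<lambda>h. (2 * k) *\<^sub>R (x - z) \<bullet> h)) (at x)"
    by (auto intro!: derivative_eq_intros simp: inner_commute algebra_simps)
  show "((\<lambda>x. (2 * k) *\<^sub>R (x - z)) has_derivative (\<lambda>h. ((2 * k) *\<^sub>R mat 1) *v h)) (at x)"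
    unfolding scaleR_matrix_vector_assoc[symmetric] matrix_vector_mul_lid
    by (auto intro!: derivative_eq_intros)
qed (simp add: mat_def)

lemma C2_on_directional:
  assumes "C2_on S u G H" "x + t *\<^sub>R e \<in> S"
  shows "((\<lambda>t. u (x + t *\<^sub>R e)) has_real_derivative G (x + t *\<^sub>R e) \<bullet> e) (at t)"
    and "((\<lambda>t. G (x + t *\<^sub>R e) \<bullet> e) has_real_derivative e \<bullet> (H (x + t *\<^sub>R e) *v e)) (at t)"
proof -
  have 1: "((\<lambda>t. x + t *\<^sub>R e) has_derivative (\<lambda>h. h *\<^sub>R e)) (at t)"
    by (auto intro!: derivative_eq_intros)
  have 2: "(u has_derivative (\<lambda>h. G (x + t *\<^sub>R e) \<bullet> h)) (at (x + t *\<^sub>R e))"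
    and 3: "(G has_derivative (\<lambda>h. H (x + t *\<^sub>R e) *v h)) (at (x + t *\<^sub>R e))"
    using assms unfolding C2_on_def by blast+
  show "((\<lambda>t. u (x + t *\<^sub>R e)) has_real_derivative G (x + t *\<^sub>R e) \<bullet> e) (at t)"
    using has_derivative_compose[OF 1 2] by (simp add: has_field_derivative_def mult_commute_abs)
  have "((\<lambda>t. G (x + t *\<^sub>R e) \<bullet> e) has_derivative (\<lambda>h. (H (x + t *\<^sub>R e) *v (h *\<^sub>R e)) \<bullet> e)) (at t)"
    using has_derivative_compose[OF 1 3] by (rule has_derivative_inner_left)
  then show "((\<lambda>t. G (x + t *\<^sub>R e) \<bullet> e) has_real_derivative e \<bullet> (H (x + t *\<^sub>R e) *v e)) (at t)"
    by (simp add: has_field_derivative_def matrix_vector_mult_scaleR mult_commute_abs inner_commute)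
qed

lemma C2_on_continuous_on: "C2_on S u G H \<Longrightarrow> continuous_on S u"
  unfolding C2_on_def
  by (meson continuous_at_imp_continuous_on has_derivative_continuous)

lemma C2_on_local_max_hessian:
  assumes C2: "C2_on (ball x r) q G H" and r: "0 < r"
    and max: "\<And>y. y \<in> ball x r \<Longrightarrow> q y \<le> q x"
  shows "z \<bullet> (H x *v z) \<le> 0"
proof -
  \<comment> \<open>The \<open>+ 1\<close> keeps the quotient meaningful when
    \<open>z = 0\<close>.\<close>
  define d where "d = r / (norm z + 1)"
  have d: "0 < d" using r by (simp add: d_def add_nonneg_pos)
  have *: "x + t *\<^sub>R z \<in> ball x r" if "\<bar>t\<bar> < d" for t
  proof -
    have "\<bar>t\<bar> * norm z \<le> \<bar>t\<bar> * (norm z + 1)" by (simp add: mult_left_mono)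
    also have "\<dots> < d * (norm z + 1)" using that by (simp add: add_nonneg_pos)
    also have "\<dots> = r" by (simp add: d_def add_nonneg_eq_0_iff)
    finally show ?thesis by (simp add: dist_norm)
  qed
  show ?thesis
    using second_derivative_local_max[of d 0 "\<lambda>t. q (x + t *\<^sub>R z)" "\<lambda>t. G (x + t *\<^sub>R z) \<bullet> z"
        "z \<bullet> (H x *v z)"] d C2_on_directional[OF C2 *] C2_on_directional(2)[OF C2 *[of 0]] max[OF *]
    by simp
qed

text \<open>The maximum principle for a constant matrix: at a maximum \<open>- H x\<close> is
  positive semidefinite, hence pairs nonnegatively with \<open>A\<close>.\<close>

lemma C2_on_local_max_inner:
  assumes "C2_on (ball x r) q G H" and r: "0 < r"
    and "\<And>y. y \<in> ball x r \<Longrightarrow> q y \<le> q x" and A: "\<And>z. 0 \<le> z \<bullet> (A *v z)"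
  shows "A \<bullet> H x \<le> 0"
proof -
  have "H x $ i $ j = H x $ j $ i" for i j
    using assms(1) r centre_in_ball[of x r] unfolding C2_on_def by blast
  then have "0 \<le> A \<bullet> (- H x)"
    using C2_on_local_max_hessian[OF assms(1-3)]
    by (intro psd_inner_nonneg[OF A])
      (simp_all add: vec_eq_iff matrix_vector_mult_def inner_vec_def sum_negf)
  then show ?thesis by simp
qed

section \<open>A difference estimate for constant coefficients\<close>

text \<open>Maximum principle for \<open>q\<close> on the cylinder \<open>K\<close> in the variables
  \<open>(x, t)\<close>: the barrier dominates the difference of \<open>w\<close> on every face, and
  a maximum in the interior contradicts the choice of \<open>B\<close>. The strict lower bound on
  \<open>B\<close> is what makes that contradiction strict.\<close>

lemma difference_bound_aux:
  fixes A :: "real^'n^'n" and w :: "real^'n \<Rightarrow> real"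
  assumes C2: "C2_on S w G H" and S: "cball z \<rho> \<subseteq> S" and \<rho>: "0 < \<rho>"
    and l: "0 < l" and ell: "\<And>\<zeta>. l * (norm \<zeta>)\<^sup>2 \<le> \<zeta> \<bullet> (A *v \<zeta>)"
    and tr: "A \<bullet> mat 1 \<le> T"
    and M: "\<And>x. x \<in> cball z \<rho> \<Longrightarrow> \<bar>w x\<bar> \<le> M"
    and F: "\<And>x. x \<in> cball z \<rho> \<Longrightarrow> \<bar>A \<bullet> H x\<bar> \<le> F"
    and e: "norm e = 1" and t: "0 \<le> t" "t \<le> \<rho> / 2"
    and B: "8 * M / \<rho>\<^sup>2 * (1 + T / l) + F / l < B"
  shows "w (z + t *\<^sub>R e) - w (z - t *\<^sub>R e) \<le> B * t * \<rho>"
proof -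
  \<comment> \<open>With this \<open>k\<close> the paraboloid equals \<open>2 * M\<close> on the
    lateral face, where the distance to \<open>z\<close> is \<open>\<rho> / 2\<close>; and
    \<open>2 * M\<close> bounds the difference of \<open>w\<close>.\<close>
  define k where "k = 8 * M / \<rho>\<^sup>2"
  \<comment> \<open>The profile \<open>t * (\<rho> - t)\<close> vanishes at \<open>t = 0\<close>, is
    increasing up to \<open>\<rho> / 2\<close>, and has second derivative \<open>- 2\<close>, which
    puts \<open>2 * B\<close> into the second \<open>t\<close>-derivative of
    \<open>q\<close>.\<close>
  define q where "q = (\<lambda>(x, t). w (x + t *\<^sub>R e) - w (x + (- t) *\<^sub>R e) - k * ((x - z) \<bullet> (x - z)) - B * (t * (\<rho> - t)))"
  define K where "K = cball z (\<rho> / 2) \<times> {0..\<rho> / 2}"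
  have M0: "0 \<le> M" using M[of z] \<rho> by force
  have F0: "0 \<le> F" using F[of z] \<rho> by force
  have k0: "0 \<le> k" using M0 by (simp add: k_def)
  \<comment> \<open>Testing ellipticity on coordinate vectors bounds the trace from below. This
    makes \<open>T\<close> positive, whence \<open>k \<le> B\<close>.\<close>
  have lT: "l \<le> T"
  proof -
    obtain i :: 'n where True by simp
    have nn: "0 \<le> A $ j $ j" for j
      using ell[of "axis j 1"] l
      by (simp add: inner_axis' matrix_vector_mult_basis column_def)
    have "l \<le> A $ i $ i"
      using ell[of "axis i 1"]
      by (simp add: inner_axis' matrix_vector_mult_basis column_def)
    also have "\<dots> \<le> (\<Sum>j\<in>UNIV. A $ j $ j)"
      by (rule member_le_sum) (auto simp: nn)
    finally show ?thesis using tr by (simp add: inner_mat_1)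
  qed
  have Bk: "k + k * T / l + F / l < B"
    using B by (simp add: k_def distrib_left)
  have kB: "k \<le> B"
    using Bk k0 F0 l lT by (smt (verit) divide_nonneg_pos mult_nonneg_nonneg)
  have in1: "x + s *\<^sub>R e \<in> cball z \<rho>" if "x \<in> cball z (\<rho> / 2)" "\<bar>s\<bar> \<le> \<rho> / 2" for x s
    using that e norm_triangle_ineq[of "x - z" "s *\<^sub>R e"]
    by (simp add: dist_norm norm_minus_commute algebra_simps)
  have wc: "continuous_on (cball z \<rho>) w"
    using C2_on_continuous_on[OF C2] S continuous_on_subset by blast
  have "compact K"
    unfolding K_def by (intro compact_Times compact_cball compact_Icc)
  moreover have "K \<noteq> {}" using \<rho> by (auto simp: K_def)
  moreover have "continuous_on K q"
  proof -
    have "continuous_on K (\<lambda>p. w (fst p + s *\<^sub>R snd p *\<^sub>R e))" if "\<bar>s\<bar> = 1" for s :: real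
    proof (rule continuous_on_compose2[OF wc])
      show "continuous_on K (\<lambda>p. fst p + s *\<^sub>R snd p *\<^sub>R e)" by (intro continuous_intros)
      show "(\<lambda>p. fst p + s *\<^sub>R snd p *\<^sub>R e) ` K \<subseteq> cball z \<rho>"
        unfolding K_def scaleR_scaleR using that by (auto simp del: mem_cball simp: abs_mult intro!: in1)
    qed
    from this[of 1] this[of "-1"] show ?thesis
      unfolding q_def case_prod_beta by (auto intro!: continuous_intros)
  qed
  ultimately obtain p where p: "p \<in> K" and max: "\<And>p'. p' \<in> K \<Longrightarrow> q p' \<le> q p"
    using continuous_attains_sup[of K q] by blast
  obtain x s where ps: "p = (x, s)" by force
  have xs: "norm (x - z) \<le> \<rho> / 2" "0 \<le> s" "s \<le> \<rho> / 2" "x \<in> cball z (\<rho>/2)"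
    using p by (auto simp: ps K_def dist_norm norm_minus_commute)
  have kr: "k * (\<rho>/2)\<^sup>2 = 2 * M" using \<rho> by (simp add: k_def power2_eq_square)
  have "q p \<le> 0"
  proof (rule ccontr)
    assume "\<not> q p \<le> 0"
    then have pos: "0 < q (x, s)" by (simp add: ps)
    have w2: "w (x + s *\<^sub>R e) - w (x + (- s) *\<^sub>R e) \<le> 2 * M"
      using M[OF in1[of x s]] M[OF in1[of x "-s"]] xs by auto
    have Bs: "0 \<le> B * (s * (\<rho> - s))"
      using xs \<rho> kB k0 by auto
    \<comment> \<open>A positive maximum avoids all three faces: at \<open>t = 0\<close> the
      difference vanishes, at \<open>t = \<rho> / 2\<close> the profile term is at least
      \<open>2 * M\<close>, and on the lateral face the paraboloid is \<open>2 * M\<close>.\<close>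
    have s0: "s \<noteq> 0" using pos k0 by (auto simp: q_def) (smt (verit) inner_ge_zero mult_nonneg_nonneg)
    have s1: "s \<noteq> \<rho> / 2"
    proof
      assume "s = \<rho> / 2"
      then have "B * (s * (\<rho> - s)) = B * (\<rho>/2)\<^sup>2"
        by (simp only:) (simp add: field_simps power2_eq_square)
      also have "\<dots> \<ge> k * (\<rho>/2)\<^sup>2" using kB by (intro mult_right_mono) auto
      finally have "2 * M \<le> B * (s * (\<rho> - s))" using kr by simp
      then show False using pos w2 k0 by (simp add: q_def) (smt (verit) inner_ge_zero mult_nonneg_nonneg)
    qed
    have x1: "norm (x - z) \<noteq> \<rho> / 2"
    proof
      assume *: "norm (x - z) = \<rho> / 2"
      have "k * ((x - z) \<bullet> (x - z)) = 2 * M"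
        using kr by (simp only: power2_norm_eq_inner[symmetric] *)
      then show False using pos w2 Bs by (simp add: q_def)
    qed
    define r where "r = \<rho> / 2 - norm (x - z)"
    have r: "0 < r" using xs x1 by (simp add: r_def)
    have sub: "y \<in> cball z (\<rho>/2)" if "y \<in> ball x r" for y
    proof -
      have "dist z y \<le> dist z x + dist x y" by (rule dist_triangle)
      then show ?thesis using that by (simp add: r_def dist_norm norm_minus_commute)
    qed
    define Q where "Q = H (x + s *\<^sub>R e) - H (x + (- s) *\<^sub>R e)"
    have C2q: "C2_on (ball x r) (\<lambda>y. q (y, s))
        (\<lambda>y. G (y + s *\<^sub>R e) - G (y + (- s) *\<^sub>R e) - (2 * k) *\<^sub>R (y - z) - 0)
        (\<lambda>y. H (y + s *\<^sub>R e) - H (y + (- s) *\<^sub>R e) - (2 * k) *\<^sub>R mat 1 - 0)"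
      unfolding q_def case_prod_conv
      by (intro C2_on_diff C2_on_quadratic C2_on_const C2_on_translate[OF C2])
        (use in1[OF sub] S xs in \<open>auto simp del: mem_cball mem_ball scaleR_minus_left\<close>)
    have "(A - l *\<^sub>R outer e e) \<bullet> (Q - (2 * k) *\<^sub>R mat 1 - 0) \<le> 0"
      unfolding Q_def
      \<comment> \<open>Subtracting \<open>l e e\<^sup>T\<close> keeps \<open>A\<close> nonnegative, and pays for adding \<open>l D\<^sub>t\<^sup>2\<close> below: both act on
        \<open>w(x + t e) - w(x - t e)\<close> as the same second derivative in direction \<open>e\<close>.\<close>
    proof (rule C2_on_local_max_inner[OF C2q r])
      show "q (y, s) \<le> q (x, s)" if "y \<in> ball x r" for y
        using max[of "(y, s)"] sub[OF that] xs by (simp add: ps K_def)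
      show "0 \<le> \<zeta> \<bullet> ((A - l *\<^sub>R outer e e) *v \<zeta>)" for \<zeta>
      proof -
        have "(\<zeta> \<bullet> e)\<^sup>2 \<le> (norm \<zeta>)\<^sup>2"
          using Cauchy_Schwarz_ineq[of \<zeta> e] e by (simp add: power2_norm_eq_inner norm_eq_1)
        then have "l * (\<zeta> \<bullet> e)\<^sup>2 \<le> l * (norm \<zeta>)\<^sup>2" using l by simp
        also note ell
        finally show ?thesis
          by (simp add: matrix_vector_mult_diff_rdistrib scaleR_matrix_vector_assoc[symmetric]
              outer_mult_vec inner_diff_right inner_commute power2_eq_square)
      qed
    qed
    then have 1: "A \<bullet> Q \<le> l * (e \<bullet> (Q *v e)) + 2 * k * (A \<bullet> mat 1) - 2 * k * l"
      using e by (simp add: inner_diff_left inner_diff_right inner_outer inner_commute[of "outer _ _"]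
          norm_eq_1 algebra_simps)
    define d where "d = min s (\<rho> / 2 - s)"
    have d: "0 < d" using s0 s1 xs by (simp add: d_def)
    \<comment> \<open>Differentiating twice in \<open>t\<close> squares away the sign in
      \<open>- t\<close>, so the difference of \<open>w\<close> contributes exactly
      \<open>e \<bullet> (Q *v e)\<close>.\<close>
    have "e \<bullet> (Q *v e) + 2 * B \<le> 0"
    proof (rule second_derivative_local_max[of d s "\<lambda>t. q (x, t)"
          "\<lambda>t. G (x + t *\<^sub>R e) \<bullet> e - - (G (x + (- t) *\<^sub>R e) \<bullet> e) - B * (\<rho> - 2 * t)", OF d])
      fix t assume t: "\<bar>t - s\<bar> < d"
      then have t': "0 \<le> t" "t \<le> \<rho> / 2" by (auto simp: d_def)
      show "q (x, t) \<le> q (x, s)"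
        using max[of "(x, t)"] t' xs by (simp add: ps K_def)
      show "((\<lambda>t. q (x, t)) has_real_derivative
          G (x + t *\<^sub>R e) \<bullet> e - - (G (x + (- t) *\<^sub>R e) \<bullet> e) - B * (\<rho> - 2 * t)) (at t)"
      proof -
        have "x + t *\<^sub>R e \<in> S" "x + t *\<^sub>R (- e) \<in> S"
          using in1[OF xs(4), of t] in1[OF xs(4), of "-t"] t' S by auto
        note C2_on_directional(1)[OF C2 this(1)] C2_on_directional(1)[OF C2 this(2)]
        then show ?thesis unfolding q_def
          by (auto intro!: derivative_eq_intros simp: algebra_simps)
      qed
    next
      have "x + s *\<^sub>R e \<in> S" "x + s *\<^sub>R (- e) \<in> S"
        using in1[OF xs(4), of s] in1[OF xs(4), of "-s"] xs S by auto
      note D1 = C2_on_directional(2)[OF C2 this(1)] and D2 = C2_on_directional(2)[OF C2 this(2)]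
      show "((\<lambda>t. G (x + t *\<^sub>R e) \<bullet> e - - (G (x + (- t) *\<^sub>R e) \<bullet> e) - B * (\<rho> - 2 * t))
         has_real_derivative e \<bullet> (Q *v e) + 2 * B) (at s)"
      proof -
        have D2': "((\<lambda>t. - (G (x + (- t) *\<^sub>R e) \<bullet> e)) has_real_derivative e \<bullet> (H (x + (- s) *\<^sub>R e) *v e)) (at s)"
          using D2 matrix_vector_mult_scaleR[of "H (x + (- s) *\<^sub>R e)" "-1" e] by simp
        show ?thesis
          by (rule derivative_eq_intros D1 D2' refl)+
            (simp add: Q_def matrix_vector_mult_diff_rdistrib inner_diff_right)
      qed
    qed
    then have "l * (e \<bullet> (Q *v e)) \<le> l * (- 2 * B)"
      using l by (intro mult_left_mono) auto
    moreover have "k * (A \<bullet> mat 1) \<le> k * T" using tr k0 by (rule mult_left_mono)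
    moreover have "- (2 * F) \<le> A \<bullet> Q"
      using F[OF in1[of x s]] F[OF in1[of x "-s"]] xs by (auto simp: Q_def inner_diff_right)
    moreover have "0 \<le> k * l" using k0 l by simp
    \<comment> \<open>The unknown \<open>e \<bullet> (Q *v e)\<close> is eliminated between the
      inequalities in \<open>x\<close> and in \<open>t\<close>; what remains contradicts the lower
      bound on \<open>B\<close>.\<close>
    ultimately have "l * B \<le> F + k * T" using 1 by linarith
    moreover have "l * k + k * T + F < l * B"
      using mult_strict_left_mono[OF Bk l] l by (simp add: distrib_left)
    ultimately show False using k0 l by (smt (verit) mult_nonneg_nonneg)
  qed
  moreover have "(z, t) \<in> K" using t \<rho> by (simp add: K_def)
  ultimately have "q (z, t) \<le> 0" using max[of "(z, t)"] by simp
  then have "w (z + t *\<^sub>R e) - w (z - t *\<^sub>R e) \<le> B * (t * (\<rho> - t))" by (simp add: q_def)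
  also have "\<dots> \<le> B * (t * \<rho>)"
    using kB k0 t by (intro mult_left_mono) auto
  finally show ?thesis by simp
qed

text \<open>The previous bound with \<open>t\<close> equal to half the distance, for
  \<open>e\<close> and \<open>- e\<close>, and with \<open>B\<close> decreasing to its threshold.
  The gain is the factor \<open>norm (x - y) / \<rho>\<close>.\<close>

lemma difference_bound:
  fixes A :: "real^'n^'n" and w :: "real^'n \<Rightarrow> real"
  assumes C2: "C2_on S w G H" and S: "cball z \<rho> \<subseteq> S" and \<rho>: "0 < \<rho>"
    and l: "0 < l" and ell: "\<And>\<zeta>. l * (norm \<zeta>)\<^sup>2 \<le> \<zeta> \<bullet> (A *v \<zeta>)"
    and tr: "A \<bullet> mat 1 \<le> T"
    and M: "\<And>x. x \<in> cball z \<rho> \<Longrightarrow> \<bar>w x\<bar> \<le> M"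
    and F: "\<And>x. x \<in> cball z \<rho> \<Longrightarrow> \<bar>A \<bullet> H x\<bar> \<le> F"
    and xy: "x + y = 2 *\<^sub>R z" "norm (x - y) \<le> \<rho>"
  shows "\<bar>w x - w y\<bar> \<le> (norm (x - y) / \<rho>) * (4 * (1 + T / l) * M + \<rho>\<^sup>2 * F / (2 * l))"
proof (cases "x = y")
  case False
  define t where "t = norm (x - y) / 2"
  define e where "e = (1 / norm (x - y)) *\<^sub>R (x - y)"
  have e: "norm e = 1" "norm (- e) = 1" using False by (simp_all add: e_def)
  have t: "0 \<le> t" "t \<le> \<rho> / 2" using xy by (auto simp: t_def)
  have te: "t *\<^sub>R e = (1/2) *\<^sub>R (x - y)" using False by (simp add: t_def e_def)
  have z: "z = (1/2) *\<^sub>R (x + y)" using xy by simp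
  have x: "x = z + t *\<^sub>R e" and y: "y = z - t *\<^sub>R e"
    unfolding te unfolding z by (simp_all add: vec_eq_iff field_simps)
  define B0 where "B0 = 8 * M / \<rho>\<^sup>2 * (1 + T / l) + F / l"
  have "\<bar>w x - w y\<bar> \<le> B * t * \<rho>" if "B0 < B" for B
    using difference_bound_aux[OF assms(1-8) e(1) t that[unfolded B0_def]]
      difference_bound_aux[OF assms(1-8) e(2) t that[unfolded B0_def]] x y by simp
  then have "\<bar>w x - w y\<bar> / (t * \<rho>) \<le> B" if "B0 < B" for B
    using that t False \<rho> by (simp add: field_simps t_def)
  then have "\<bar>w x - w y\<bar> / (t * \<rho>) \<le> B0" by (meson dense not_le order.strict_trans1)
  then have "\<bar>w x - w y\<bar> \<le> B0 * (t * \<rho>)"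
    using False \<rho> by (simp add: field_simps t_def)
  also have "B0 * (t * \<rho>) = (norm (x - y) / \<rho>) * (4 * (1 + T / l) * M + \<rho>\<^sup>2 * F / (2 * l))"
    using \<rho> l by (simp add: B0_def t_def field_simps power2_eq_square)
  finally show ?thesis .
qed simp

section \<open>Functions with continuous partial derivatives\<close>

text \<open>Moves the derivative at \<open>0\<close> in the definition of
  \<open>partial_deriv\<close> to any point of the line. The scaling by \<open>h\<close> lets
  \<open>partial_mvt\<close> work on the unit interval for steps of either sign.\<close>

lemma has_partial_line:
  assumes "has_partial i u (y + (t * h) *\<^sub>R axis i 1)"
  shows "((\<lambda>t. u (y + (t * h) *\<^sub>R axis i 1)) has_real_derivative
           h * partial_deriv i u (y + (t * h) *\<^sub>R axis i 1)) (at t)"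
proof -
  let ?z = "y + (t * h) *\<^sub>R axis i 1"
  have 1: "((\<lambda>t. u (?z + t *\<^sub>R axis i 1)) has_real_derivative partial_deriv i u ?z) (at 0)"
    using assms DERIV_deriv_iff_field_differentiable unfolding has_partial_def partial_deriv_def by blast
  have 2: "((\<lambda>s. (s - t) * h) has_real_derivative h) (at t)"
    by (auto intro!: derivative_eq_intros)
  have "((\<lambda>s. u (?z + ((s - t) * h) *\<^sub>R axis i 1)) has_real_derivative partial_deriv i u ?z * h) (at t)"
    using DERIV_chain2[of "\<lambda>t. u (?z + t *\<^sub>R axis i 1)" _ "\<lambda>s. (s - t) * h" t h UNIV] 1 2 by simp
  moreover have "?z + ((s - t) * h) *\<^sub>R axis i 1 = y + (s * h) *\<^sub>R axis i 1" for s
    by (simp add: algebra_simps)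
  ultimately show ?thesis by (simp only: mult.commute[of _ h])
qed

lemma partial_mvt:
  assumes "\<And>t. 0 \<le> t \<Longrightarrow> t \<le> 1 \<Longrightarrow> has_partial i u (y + (t * h) *\<^sub>R axis i 1)"
  obtains t where "0 < t" "t < 1"
    "u (y + h *\<^sub>R axis i 1) - u y = h * partial_deriv i u (y + (t * h) *\<^sub>R axis i 1)"
  using MVT2[of 0 1 "\<lambda>t. u (y + (t * h) *\<^sub>R axis i 1)", OF _ has_partial_line] assms by auto

text \<open>Coordinates are changed one at a time, each by the one-dimensional mean value theorem.
  The base point \<open>y\<close> is free and the condition bounds its distance plus the total
  length still to go, so that the induction can move \<open>y\<close> and stay in the ball.\<close>

lemma partial_increment_bound:
  assumes "finite J"
    and P: "\<And>y i. y \<in> ball x \<delta> \<Longrightarrow> has_partial i u y"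
    and C: "\<And>y i. y \<in> ball x \<delta> \<Longrightarrow> \<bar>partial_deriv i u y - g i\<bar> \<le> \<epsilon>"
    and "dist x y + (\<Sum>i\<in>J. \<bar>h $ i\<bar>) < \<delta>"
  shows "\<bar>u (y + (\<Sum>i\<in>J. (h $ i) *\<^sub>R axis i 1)) - u y - (\<Sum>i\<in>J. h $ i * g i)\<bar> \<le> \<epsilon> * (\<Sum>i\<in>J. \<bar>h $ i\<bar>)"
  using assms(1,4)
proof (induction J arbitrary: y rule: finite_induct)
  case (insert i J)
  define y' where "y' = y + (h $ i) *\<^sub>R axis i 1"
  have d: "dist x (y + (t * h $ i) *\<^sub>R axis i 1) \<le> dist x y + \<bar>h $ i\<bar>" if "0 \<le> t" "t \<le> 1" for t
  proof -
    have "dist x (y + (t * h $ i) *\<^sub>R axis i 1) \<le> dist x y + dist y (y + (t * h $ i) *\<^sub>R axis i 1)"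
      by (rule dist_triangle)
    also have "dist y (y + (t * h $ i) *\<^sub>R axis i 1) = t * \<bar>h $ i\<bar>"
      using that by (simp add: dist_norm abs_mult)
    also have "\<dots> \<le> \<bar>h $ i\<bar>" using that by (simp add: mult_left_le_one_le)
    finally show ?thesis by simp
  qed
  have nn: "0 \<le> (\<Sum>i\<in>J. \<bar>h $ i\<bar>)" by (simp add: sum_nonneg)
  have 1: "\<bar>u (y' + (\<Sum>i\<in>J. (h $ i) *\<^sub>R axis i 1)) - u y' - (\<Sum>i\<in>J. h $ i * g i)\<bar> \<le> \<epsilon> * (\<Sum>i\<in>J. \<bar>h $ i\<bar>)"
    by (rule insert.IH) (use d[of 1] insert in \<open>simp add: y'_def\<close>)
  have in_ball: "y + (t * h $ i) *\<^sub>R axis i 1 \<in> ball x \<delta>" if "0 \<le> t" "t \<le> 1" for t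
    using d[OF that] insert.prems nn unfolding sum.insert[OF insert.hyps] mem_ball by linarith
  obtain t where t: "0 < t" "t < 1"
    and eq: "u (y + h $ i *\<^sub>R axis i 1) - u y = h $ i * partial_deriv i u (y + (t * h $ i) *\<^sub>R axis i 1)"
    by (rule partial_mvt[of i u y "h $ i"]) (use P in_ball in auto)
  have "u y' - u y - h $ i * g i = h $ i * (partial_deriv i u (y + (t * h $ i) *\<^sub>R axis i 1) - g i)"
    using eq by (simp add: y'_def algebra_simps)
  then have "\<bar>u y' - u y - h $ i * g i\<bar> = \<bar>h $ i\<bar> * \<bar>partial_deriv i u (y + (t * h $ i) *\<^sub>R axis i 1) - g i\<bar>"
    by (simp add: abs_mult)
  also have "\<dots> \<le> \<bar>h $ i\<bar> * \<epsilon>"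
    using C[OF in_ball[of t]] t by (intro mult_left_mono) auto
  finally have "\<bar>u y' - u y - h $ i * g i\<bar> \<le> \<bar>h $ i\<bar> * \<epsilon>" .
  with 1 insert.hyps show ?case
    by (simp add: y'_def algebra_simps)
qed simp

lemma has_derivative_continuous_partials:
  fixes u :: "real^'n \<Rightarrow> real"
  assumes S: "open S" and x: "x \<in> S"
    and P: "\<And>y i. y \<in> S \<Longrightarrow> has_partial i u y"
    and C: "\<And>i. continuous_on S (partial_deriv i u)"
  shows "(u has_derivative (\<lambda>h. (\<chi> i. partial_deriv i u x) \<bullet> h)) (at x)"
  unfolding has_derivative_at_alt
proof (intro conjI allI impI bounded_linear_inner_right)
  fix e :: real assume e: "0 < e"
  define n where "n = real CARD('n)"
  have n: "0 < n" by (simp add: n_def)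
  \<comment> \<open>The division by \<open>n\<close>, here and in the radius
    \<open>\<delta> / n\<close>, pays for comparing the sum of the coordinates with the Euclidean
    norm.\<close>
  define \<epsilon> where "\<epsilon> = e / n"
  have \<epsilon>: "0 < \<epsilon>" using e n by (simp add: \<epsilon>_def)
  have "\<forall>\<^sub>F y in at x. \<forall>i. \<bar>partial_deriv i u y - partial_deriv i u x\<bar> < \<epsilon>"
  proof (rule eventually_all_finite)
    fix i
    have "(partial_deriv i u \<longlongrightarrow> partial_deriv i u x) (at x)"
      using C S x continuous_on_eq_continuous_at isCont_def by blast
    then show "\<forall>\<^sub>F y in at x. \<bar>partial_deriv i u y - partial_deriv i u x\<bar> < \<epsilon>"
      using \<epsilon> tendstoD by (fastforce simp: dist_real_def)
  qed
  then obtain \<delta>1 where d1: "0 < \<delta>1" and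
    c: "\<And>y i. y \<noteq> x \<Longrightarrow> dist y x < \<delta>1 \<Longrightarrow> \<bar>partial_deriv i u y - partial_deriv i u x\<bar> < \<epsilon>"
    unfolding eventually_at by auto
  obtain \<delta>2 where d2: "0 < \<delta>2" "ball x \<delta>2 \<subseteq> S" using S x open_contains_ball by blast
  define \<delta> where "\<delta> = min \<delta>1 \<delta>2"
  have d: "0 < \<delta>" using d1 d2 by (simp add: \<delta>_def)
  show "\<exists>d>0. \<forall>y. norm (y - x) < d \<longrightarrow>
      norm (u y - u x - (\<chi> i. partial_deriv i u x) \<bullet> (y - x)) \<le> e * norm (y - x)"
  proof (intro exI[of _ "\<delta> / n"] conjI allI impI)
    show "0 < \<delta> / n" using d n by simp
    fix y assume y: "norm (y - x) < \<delta> / n"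
    define h where "h = y - x"
    have sum: "(\<Sum>i\<in>UNIV. \<bar>h $ i\<bar>) \<le> n * norm h"
      using sum_bounded_above[of UNIV "\<lambda>i. \<bar>h $ i\<bar>" "norm h"] by (simp add: n_def component_le_norm_cart)
    have exp: "(\<Sum>i\<in>UNIV. (h $ i) *\<^sub>R axis i 1) = h"
      using basis_expansion[of h] by (simp add: scalar_mult_eq_scaleR)
    have "\<bar>u (x + (\<Sum>i\<in>UNIV. (h $ i) *\<^sub>R axis i 1)) - u x - (\<Sum>i\<in>UNIV. h $ i * partial_deriv i u x)\<bar>
        \<le> \<epsilon> * (\<Sum>i\<in>UNIV. \<bar>h $ i\<bar>)"
    proof (rule partial_increment_bound[where \<delta> = \<delta> and x = x])
      show "has_partial i u y" if "y \<in> ball x \<delta>" for y i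
        using that d2 P by (auto simp: \<delta>_def)
      show "\<bar>partial_deriv i u y - partial_deriv i u x\<bar> \<le> \<epsilon>" if "y \<in> ball x \<delta>" for y i
        using c[of y i] that \<epsilon> by (cases "y = x") (auto simp: \<delta>_def dist_commute)
      have "n * norm h < \<delta>" using y n by (simp add: h_def field_simps)
      then show "dist x x + (\<Sum>i\<in>UNIV. \<bar>h $ i\<bar>) < \<delta>" using sum by simp
    qed simp
    also have "\<dots> \<le> \<epsilon> * (n * norm h)" using sum \<epsilon> by simp
    also have "\<dots> = e * norm h" using n by (simp add: \<epsilon>_def)
    finally show "norm (u y - u x - (\<chi> i. partial_deriv i u x) \<bullet> (y - x)) \<le> e * norm (y - x)"
      unfolding exp by (simp add: h_def inner_vec_def mult.commute)
  qed
qed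

section \<open>Double differences and the symmetry of second derivatives\<close>

lemma D_simps: "D [] u = u" "D (i # \<beta>) u = partial_deriv i (D \<beta> u)"
  by (simp_all add: D_def)

text \<open>The codomain is a general normed space because the same difference is taken of the
  gradient and of the Hessian.\<close>

definition double_diff ::
    "'n \<Rightarrow> 'n \<Rightarrow> real \<Rightarrow> (real^'n \<Rightarrow> 'b::real_normed_vector) \<Rightarrow> real^'n \<Rightarrow> 'b" where
  "double_diff i j s u x = u (x + s *\<^sub>R axis j 1 + s *\<^sub>R axis i 1) - u (x + s *\<^sub>R axis j 1)
     - (u (x + s *\<^sub>R axis i 1) - u x)"

lemma axis_steps:
  fixes x :: "real^'n"
  assumes "0 \<le> a" "a \<le> s" "0 \<le> b" "b \<le> s"
  shows "x + a *\<^sub>R axis j 1 + b *\<^sub>R axis i 1 \<in> cball x (2 * s)"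
proof -
  have "dist x (x + v) = norm v" for v by (simp add: dist_norm)
  then show ?thesis
    using assms norm_triangle_ineq[of "a *\<^sub>R axis j (1::real)" "b *\<^sub>R axis i 1"]
    by (simp add: add.assoc)
qed

lemma double_diff_commute: "double_diff i j s u x = double_diff j i s u x"
  by (simp add: double_diff_def algebra_simps)

lemma C2_on_double_diff:
  assumes C2: "C2_on \<Omega> u G H" and T: "\<And>x. x \<in> T \<Longrightarrow> cball x (2 * s) \<subseteq> \<Omega>" and s: "0 \<le> s"
  shows "C2_on T (double_diff i j s u) (double_diff i j s G) (double_diff i j s H)"
proof -
  have *: "x + a *\<^sub>R axis j 1 + b *\<^sub>R axis i 1 \<in> \<Omega>"
    if "x \<in> T" "0 \<le> a" "a \<le> s" "0 \<le> b" "b \<le> s" for x a b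
    using axis_steps that T by blast
  show ?thesis
    unfolding double_diff_def add.assoc
    using *[of _ s s] *[of _ s 0] *[of _ 0 s] *[of _ 0 0] s
    by (intro C2_on_diff C2_on_translate[OF C2] C2_on_subset[OF C2]) (auto simp: add.assoc)
qed

lemma C_open_partial:
  assumes "u \<in> C_open k S" "length \<beta> < k" "x \<in> S"
  shows "has_partial i (D \<beta> u) x"
  using assms by (simp add: C_open_def)

lemma has_partial_diff:
  assumes "has_partial i u x" "has_partial i v x"
  shows "has_partial i (\<lambda>x. u x - v x) x"
    and "partial_deriv i (\<lambda>x. u x - v x) x = partial_deriv i u x - partial_deriv i v x"
  using assms unfolding has_partial_def partial_deriv_def
  by (auto intro: field_differentiable_diff)

lemma has_partial_translate:
  "has_partial i (\<lambda>x. u (x + k)) x \<longleftrightarrow> has_partial i u (x + k)"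
  "partial_deriv i (\<lambda>x. u (x + k)) x = partial_deriv i u (x + k)"
  unfolding has_partial_def partial_deriv_def
  by (simp_all only: add.assoc add.commute[of _ k] add.left_commute[of _ k])

text \<open>Two mean value theorems: in direction \<open>j\<close> for the difference
  \<open>?v\<close> taken in direction \<open>i\<close>, then in direction \<open>i\<close> for
  \<open>D [j] u\<close>. Symmetry of the second derivatives is not presupposed, so it can be
  deduced from this lemma.\<close>

lemma double_diff_mvt:
  assumes u: "u \<in> C_open 2 S" and S: "cball x (2 * s) \<subseteq> S" and s: "0 \<le> s"
  obtains \<xi> where "\<xi> \<in> cball x (2 * s)" "double_diff i j s u x = s\<^sup>2 * D [i, j] u \<xi>"
proof -
  have p1: "has_partial k u y" "has_partial k (D [j] u) y" if "y \<in> S" for y k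
    using C_open_partial[OF u _ that, of "[]"] C_open_partial[OF u _ that, of "[j]"] by (auto simp: D_simps)
  let ?v = "\<lambda>x. u (x + s *\<^sub>R axis i 1) - u x"
  have in2: "x + (t * s) *\<^sub>R axis j 1 + b *\<^sub>R axis i 1 \<in> S" if "0 \<le> t" "t \<le> 1" "0 \<le> b" "b \<le> s" for t b
    using axis_steps[of "t * s" s b x j i] that s S by (auto simp: mult_left_le_one_le)
  have in1: "x + (t * s) *\<^sub>R axis j 1 \<in> S" "x + s *\<^sub>R axis i 1 \<in> S" if "0 \<le> t" "t \<le> 1" for t
    using in2[of t 0] in2[of 0 s] that s by simp_all
  obtain t where t: "0 < t" "t < 1"
    and 1: "?v (x + s *\<^sub>R axis j 1) - ?v x = s * partial_deriv j ?v (x + (t * s) *\<^sub>R axis j 1)"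
    by (rule partial_mvt[of j ?v x s])
      (use in1 in2 s in \<open>auto intro!: has_partial_diff p1 simp: has_partial_translate\<close>)
  have 2: "partial_deriv j ?v (x + (t * s) *\<^sub>R axis j 1)
     = D [j] u (x + (t * s) *\<^sub>R axis j 1 + s *\<^sub>R axis i 1) - D [j] u (x + (t * s) *\<^sub>R axis j 1)"
    using in1[of t] in2[of t s] t s
    by (subst has_partial_diff) (auto intro!: p1 simp: has_partial_translate D_simps)
  obtain r where r: "0 < r" "r < 1" and
   3: "D [j] u (x + (t * s) *\<^sub>R axis j 1 + s *\<^sub>R axis i 1) - D [j] u (x + (t * s) *\<^sub>R axis j 1)
     = s * partial_deriv i (D [j] u) (x + (t * s) *\<^sub>R axis j 1 + (r * s) *\<^sub>R axis i 1)"
    by (rule partial_mvt[of i "D [j] u" "x + (t * s) *\<^sub>R axis j 1" s])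
      (use in2 s t in \<open>auto intro!: p1 simp: mult_left_le_one_le\<close>)
  show ?thesis
  proof (rule that[of "x + (t * s) *\<^sub>R axis j 1 + (r * s) *\<^sub>R axis i 1"])
    show "x + (t * s) *\<^sub>R axis j 1 + (r * s) *\<^sub>R axis i 1 \<in> cball x (2 * s)"
      using t r s by (intro axis_steps) (auto simp: mult_left_le_one_le)
    show "double_diff i j s u x = s\<^sup>2 * D [i, j] u (x + (t * s) *\<^sub>R axis j 1 + (r * s) *\<^sub>R axis i 1)"
      using 1 2 3 by (simp add: double_diff_def power2_eq_square D_simps)
  qed
qed

text \<open>The double difference is symmetric in \<open>i\<close> and \<open>j\<close>, so
  \<open>D [i, j] u\<close> and \<open>D [j, i] u\<close> agree at two points near \<open>x\<close>;
  continuity brings both points to \<open>x\<close>.\<close>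

lemma D2_symmetric:
  assumes u: "u \<in> C_open 2 S" and S: "open S" and x: "x \<in> S"
  shows "D [i, j] u x = D [j, i] u x"
proof -
  have "\<bar>D [i, j] u x - D [j, i] u x\<bar> \<le> 0 + e" if e: "0 < e" for e
  proof -
    have cont: "continuous_on S (D [i, j] u)" for i j
      using u by (simp add: C_open_def)
    have "\<exists>d>0. \<forall>y. dist y x < d \<longrightarrow> dist (D [i, j] u y) (D [i, j] u x) < e / 2" for i j
      using cont S x e continuous_on_eq_continuous_at[of S "D [i, j] u"] unfolding continuous_at_eps_delta
      by (meson half_gt_zero)
    then obtain d where d: "0 < d i j" "\<And>y. dist y x < d i j \<Longrightarrow> dist (D [i, j] u y) (D [i, j] u x) < e / 2" for i j
      by metis
    obtain r where r: "0 < r" "ball x r \<subseteq> S" using S x open_contains_ball by blast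
    define m where "m = min r (min (d i j) (d j i))"
    have m: "0 < m" using r d by (simp add: m_def)
    define s where "s = m / 4"
    have s: "0 < s" using m by (simp add: s_def)
    have sub: "cball x (2 * s) \<subseteq> ball x m" using m by (auto simp: s_def)
    moreover have "ball x m \<subseteq> ball x r" by (auto simp: m_def)
    ultimately have S': "cball x (2 * s) \<subseteq> S" using r by blast
    obtain \<xi> where \<xi>: "\<xi> \<in> cball x (2 * s)" "double_diff i j s u x = s\<^sup>2 * D [i, j] u \<xi>"
      using double_diff_mvt[OF u S'] s by (metis less_imp_le)
    obtain \<eta> where \<eta>: "\<eta> \<in> cball x (2 * s)" "double_diff j i s u x = s\<^sup>2 * D [j, i] u \<eta>"
      using double_diff_mvt[OF u S'] s by (metis less_imp_le)
    have "D [i, j] u \<xi> = D [j, i] u \<eta>"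
      using \<xi> \<eta> s double_diff_commute[of i j s u x] by simp
    moreover have lt: "dist y x < d i j \<and> dist y x < d j i" if "y \<in> cball x (2 * s)" for y
      using subsetD[OF sub that] by (auto simp: m_def dist_commute)
    moreover have "dist (D [i, j] u \<xi>) (D [i, j] u x) < e / 2"
      using d(2)[of \<xi> i j] lt[OF \<xi>(1)] by blast
    moreover have "dist (D [j, i] u \<eta>) (D [j, i] u x) < e / 2"
      using d(2)[of \<eta> j i] lt[OF \<eta>(1)] by blast
    ultimately show ?thesis unfolding dist_real_def by linarith
  qed
  then show ?thesis using field_le_epsilon[of "\<bar>D [i, j] u x - D [j, i] u x\<bar>" 0] by simp
qed

lemma C_open_imp_C2_on:
  assumes u: "u \<in> C_open 2 S" and S: "open S"
  shows "C2_on S u (\<lambda>x. \<chi> i. D [i] u x) (\<lambda>x. \<chi> i j. D [i, j] u x)"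
  unfolding C2_on_def
proof (intro ballI conjI allI)
  fix x assume x: "x \<in> S"
  have cont: "continuous_on S (D \<beta> u)" if "length \<beta> \<le> 2" for \<beta>
    using u that by (simp add: C_open_def)
  show "(u has_derivative (\<lambda>h. (\<chi> i. D [i] u x) \<bullet> h)) (at x)"
    using has_derivative_continuous_partials[OF S x, of u] C_open_partial[OF u, of "[]"] cont[of "[_]"]
    by (simp add: D_simps)
  have "(D [i] u has_derivative (\<lambda>h. (\<chi> j. D [j, i] u x) \<bullet> h)) (at x)" for i
    using has_derivative_continuous_partials[OF S x, of "D [i] u"] C_open_partial[OF u, of "[i]"]
      cont[of "[_, i]"]
    by (simp add: D_simps)
  \<comment> \<open>The gradient of \<open>D [i] u\<close> has entries \<open>D [j, i] u\<close>;
    symmetry turns it into row \<open>i\<close> of the Hessian.\<close>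
  moreover have "(\<chi> j. D [j, i] u x) \<bullet> h = ((\<chi> i j. D [i, j] u x) *v h) $ i" for i h
    using D2_symmetric[OF u S x] by (simp add: inner_vec_def matrix_vector_mult_def)
  ultimately show "((\<lambda>x. \<chi> i. D [i] u x) has_derivative (*v) (\<chi> i j. D [i, j] u x)) (at x)"
    by (subst has_derivative_componentwise_within) (auto simp: Basis_vec_def inner_axis)
  show "(\<chi> i j. D [i, j] u x) $ i $ j = (\<chi> i j. D [i, j] u x) $ j $ i" for i j
    using D2_symmetric[OF u S x] by simp
qed

section \<open>Distance to the boundary and interpolation\<close>

lemma bdist_pos:
  assumes "open \<Omega>" "bounded \<Omega>" "x \<in> \<Omega>"
  shows "0 < bdist \<Omega> x"
proof -
  \<comment> \<open>\<open>infdist\<close> to the empty set is \<open>0\<close> by convention, so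
    the boundary must be shown nonempty; boundedness rules out the whole space.\<close>
  have "frontier \<Omega> \<noteq> {}"
    using assms frontier_eq_empty not_bounded_UNIV by blast
  moreover have "x \<notin> frontier \<Omega>"
    using assms by (simp add: frontier_def interior_open)
  ultimately show ?thesis
    unfolding bdist_def by (intro infdist_pos_not_in_closed) auto
qed

lemma bdist_triangle: "bdist \<Omega> x \<le> bdist \<Omega> y + dist x y"
  unfolding bdist_def by (rule infdist_triangle)

text \<open>A connected ball that meets both \<Omega> and its complement contains a boundary point,
  which would be closer to \<open>x\<close> than \<open>bdist \<Omega> x\<close>.\<close>

lemma bdist_ball_subset:
  assumes "x \<in> \<Omega>" shows "ball x (bdist \<Omega> x) \<subseteq> \<Omega>"
proof (rule ccontr)
  assume "\<not> ?thesis"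
  then obtain y where y: "y \<in> ball x (bdist \<Omega> x)" "y \<notin> \<Omega>" by blast
  then have "x \<in> ball x (bdist \<Omega> x)"
    using le_less_trans[OF zero_le_dist] by (metis centre_in_ball mem_ball)
  with y assms have "ball x (bdist \<Omega> x) - \<Omega> \<noteq> {}" "ball x (bdist \<Omega> x) \<inter> \<Omega> \<noteq> {}"
    by blast+
  then obtain z where "z \<in> ball x (bdist \<Omega> x)" "z \<in> frontier \<Omega>"
    using connected_Int_frontier[of "ball x (bdist \<Omega> x)" \<Omega>] by auto
  then show False
    using infdist_le[of z "frontier \<Omega>" x] by (simp add: bdist_def)
qed

lemma bdist_le_diameter:
  assumes "open \<Omega>" "bounded \<Omega>" "x \<in> \<Omega>"
  shows "bdist \<Omega> x \<le> diameter \<Omega>"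
proof -
  have "frontier \<Omega> \<noteq> {}"
    using assms frontier_eq_empty not_bounded_UNIV by blast
  then obtain z where z: "z \<in> frontier \<Omega>" by blast
  have "bdist \<Omega> x \<le> dist x z"
    unfolding bdist_def by (rule infdist_le[OF z])
  also have "\<dots> \<le> diameter (closure \<Omega>)"
    using assms z closure_subset[of \<Omega>]
    by (intro diameter_bounded_bound) (auto simp: frontier_def bounded_closure)
  finally show ?thesis using diameter_closure[OF assms(2)] by simp
qed

text \<open>Removes the weights from a weighted Hoelder bound: the boundary distance is lowered to a
  fixed scale \<delta> and the separation raised to \<open>r\<close>, leaving a power of
  \<open>r / \<delta>\<close> and a power of \<delta>.\<close>

lemma weighted_quotient_bound:
  fixes g :: real
  assumes "d powr (s + a) * (\<bar>g\<bar> / R powr a) \<le> S" "0 < \<delta>" "\<delta> \<le> d" "0 < R" "R \<le> r" "0 < a" "0 \<le> s"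
  shows "\<bar>g\<bar> \<le> S * (r / \<delta>) powr a / \<delta> powr s"
proof -
  have "\<delta> powr (s + a) * (\<bar>g\<bar> / R powr a) \<le> d powr (s + a) * (\<bar>g\<bar> / R powr a)"
    using assms by (intro mult_right_mono powr_mono2) auto
  then have *: "\<delta> powr (s + a) * (\<bar>g\<bar> / R powr a) \<le> S" using assms by simp
  have "0 \<le> \<delta> powr (s + a) * (\<bar>g\<bar> / R powr a)" by simp
  then have S: "0 \<le> S" using * by linarith
  have "\<bar>g\<bar> = (\<delta> powr (s + a) * (\<bar>g\<bar> / R powr a)) * ((R / \<delta>) powr a / \<delta> powr s)"
    using assms by (simp add: powr_divide powr_add)
  also have "\<dots> \<le> S * ((R / \<delta>) powr a / \<delta> powr s)"
    using * by (intro mult_right_mono) auto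
  also have "\<dots> \<le> S * ((r / \<delta>) powr a / \<delta> powr s)"
    using S assms by (intro mult_left_mono divide_right_mono powr_mono2) (auto simp: divide_right_mono)
  finally show ?thesis by simp
qed

lemma lipschitz_from_partials:
  fixes v :: "real^'n \<Rightarrow> real"
  assumes S: "open S" "cball x0 R \<subseteq> S"
    and P: "\<And>y i. y \<in> S \<Longrightarrow> has_partial i v y"
    and C: "\<And>i. continuous_on S (partial_deriv i v)"
    and B: "\<And>y i. y \<in> cball x0 R \<Longrightarrow> \<bar>partial_deriv i v y\<bar> \<le> m"
    and x: "dist x0 x \<le> R"
  shows "\<bar>v x - v x0\<bar> \<le> real CARD('n) * m * R"
proof -
  have R: "0 \<le> R" using x zero_le_dist[of x0 x] by linarith
  then have m: "0 \<le> m" using order_trans[OF abs_ge_zero B[of x0]] by simp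
  have "norm (v x - v x0) \<le> (real CARD('n) * m) * norm (x - x0)"
  proof (rule differentiable_bound[of "cball x0 R" v "\<lambda>y h. (\<chi> i. partial_deriv i v y) \<bullet> h"])
    fix y assume y: "y \<in> cball x0 R"
    show "(v has_derivative (\<lambda>h. (\<chi> i. partial_deriv i v y) \<bullet> h)) (at y within cball x0 R)"
      using has_derivative_continuous_partials[OF S(1) _ P C] y S has_derivative_at_withinI by blast
    show "onorm ((\<bullet>) (\<chi> i. partial_deriv i v y)) \<le> real CARD('n) * m"
    proof (rule onorm_le)
      fix h :: "real^'n"
      have "norm (\<chi> i. partial_deriv i v y) \<le> (\<Sum>i\<in>UNIV. \<bar>partial_deriv i v y\<bar>)"
        using norm_le_l1_cart[of "\<chi> i. partial_deriv i v y"] by simp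
      also have "\<dots> \<le> real CARD('n) * m"
        using sum_bounded_above[of UNIV "\<lambda>i. \<bar>partial_deriv i v y\<bar>" m] B[OF y] by simp
      finally have "norm (\<chi> i. partial_deriv i v y) * norm h \<le> real CARD('n) * m * norm h"
        by (rule mult_right_mono) simp
      then show "norm ((\<chi> i. partial_deriv i v y) \<bullet> h) \<le> real CARD('n) * m * norm h"
        using Cauchy_Schwarz_ineq2[of "\<chi> i. partial_deriv i v y" h] by simp
    qed
  qed (use x R in auto)
  also have "\<dots> \<le> (real CARD('n) * m) * R"
    using m x by (intro mult_left_mono) (auto simp: dist_norm norm_minus_commute)
  finally show ?thesis by simp
qed

text \<open>Here \<open>S\<close> is any real bound for the weighted Hoelder quotients of the second
  derivatives; that it is the least one enters only in the absorption. The exponent is always taken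
  at the first point.\<close>

locale interior_C2 =
  fixes \<Omega> :: "(real^'n) set" and \<alpha> :: "real^'n \<Rightarrow> real" and u :: "real^'n \<Rightarrow> real"
    and S U0 am :: real
  assumes open_\<Omega>: "open \<Omega>" and bounded_\<Omega>: "bounded \<Omega>"
    and am: "0 < am" and exponent: "\<And>x. x \<in> \<Omega> \<Longrightarrow> am \<le> \<alpha> x \<and> \<alpha> x \<le> 1"
    and u: "u \<in> C_open 2 \<Omega>"
    and U0: "\<And>x. x \<in> \<Omega> \<Longrightarrow> \<bar>u x\<bar> \<le> U0"
    and S: "0 \<le> S"
    and holder: "\<And>x y i j. x \<in> \<Omega> \<Longrightarrow> y \<in> \<Omega> \<Longrightarrow> x \<noteq> y \<Longrightarrow>
      bdist2 \<Omega> x y powr (2 + \<alpha> x) * (\<bar>D [i, j] u x - D [i, j] u y\<bar> / norm (x - y) powr \<alpha> x) \<le> S"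
begin

lemma partials:
  "x \<in> \<Omega> \<Longrightarrow> has_partial i u x" "x \<in> \<Omega> \<Longrightarrow> has_partial i (D [j] u) x"
  "continuous_on \<Omega> (partial_deriv i u)" "continuous_on \<Omega> (partial_deriv i (D [j] u))"
proof -
  have "continuous_on \<Omega> (D \<beta> u)" if "length \<beta> \<le> 2" for \<beta>
    using u that by (simp add: C_open_def)
  from this[of "[i]"] this[of "[i, j]"]
  show "continuous_on \<Omega> (partial_deriv i u)" "continuous_on \<Omega> (partial_deriv i (D [j] u))"
    by (simp_all add: D_simps)
qed (use C_open_partial[OF u, of "[]"] C_open_partial[OF u, of "[j]"] in \<open>simp_all add: D_simps\<close>)

lemma alpha_pos: "x \<in> \<Omega> \<Longrightarrow> 0 < \<alpha> x"
  using exponent am by fastforce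

text \<open>Asking for \<open>2 * \<delta>\<close> at the centre leaves a distance of at least
  \<delta> to the boundary throughout the ball of radius \<delta>.\<close>

lemma near:
  assumes x: "x \<in> \<Omega>" and \<delta>: "0 < \<delta>" "2 * \<delta> \<le> bdist \<Omega> x" and y: "dist x y \<le> \<delta>"
  shows "y \<in> \<Omega>" "\<delta> \<le> bdist \<Omega> y" "\<delta> \<le> bdist2 \<Omega> x y"
proof -
  have "y \<in> ball x (bdist \<Omega> x)" using assms by simp
  then show "y \<in> \<Omega>" using bdist_ball_subset[OF x] by blast
  show "\<delta> \<le> bdist \<Omega> y" using bdist_triangle[of \<Omega> x y] assms by linarith
  then show "\<delta> \<le> bdist2 \<Omega> x y" using \<delta> by (simp add: bdist2_def)
qed

lemma holder_near:
  assumes x: "x \<in> \<Omega>" and \<delta>: "0 < \<delta>" "2 * \<delta> \<le> bdist \<Omega> x" and r: "r \<le> \<delta>" and y: "dist x y \<le> r"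
  shows "\<bar>D [i, j] u x - D [i, j] u y\<bar> \<le> S * (r / \<delta>) powr \<alpha> x / \<delta>\<^sup>2"
proof (cases "x = y")
  case False
  have "\<bar>D [i, j] u x - D [i, j] u y\<bar> \<le> S * (r / \<delta>) powr \<alpha> x / \<delta> powr 2"
    by (rule weighted_quotient_bound[OF holder[of x y i j]])
      (use assms False near[OF x \<delta>, of y] alpha_pos[OF x] in \<open>auto simp: dist_norm\<close>)
  then show ?thesis using \<delta> by (simp add: powr_numeral)
qed (use S in simp)

text \<open>The scaled double difference at \<open>y\<close> is a value of \<open>D [i, j] u\<close>
  within distance \<open>r\<close> of \<open>x\<close>. It is compared with the centre
  \<open>x\<close>, so the exponent is \<open>\<alpha> x\<close> wherever \<open>y\<close>
  lies.\<close>

lemma double_diff_holder: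
  assumes x: "x \<in> \<Omega>" and \<delta>: "0 < \<delta>" "2 * \<delta> \<le> bdist \<Omega> x" and s: "0 < s"
    and r: "r \<le> \<delta>" and y: "dist x y + 2 * s \<le> r"
  shows "\<bar>double_diff i j s u y / s\<^sup>2 - D [i, j] u x\<bar> \<le> S * (r / \<delta>) powr \<alpha> x / \<delta>\<^sup>2"
proof -
  have *: "dist x z \<le> r" if "z \<in> cball y (2 * s)" for z
    using that y dist_triangle[of x z y] by simp
  have "cball y (2 * s) \<subseteq> \<Omega>"
    using near[OF x \<delta>] * r by force
  then obtain \<xi> where "\<xi> \<in> cball y (2 * s)" "double_diff i j s u y = s\<^sup>2 * D [i, j] u \<xi>"
    using double_diff_mvt[OF u] s by (metis less_imp_le)
  then show ?thesis
    using holder_near[OF x \<delta> r *, of \<xi>] s by (simp add: abs_minus_commute)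
qed

text \<open>A difference quotient with step \<eta> times the boundary distance is controlled by
  \<open>U0\<close>; its deviation from the derivative is controlled by \<open>S\<close> with a
  factor that is small with \<eta>.\<close>

lemma interpolation_2:
  assumes x: "x \<in> \<Omega>" and \<eta>: "0 < \<eta>" "\<eta> \<le> 1 / 4"
  shows "(bdist \<Omega> x)\<^sup>2 * \<bar>D [i, j] u x\<bar> \<le> 4 * U0 / \<eta>\<^sup>2 + 4 * S * (4 * \<eta>) powr am"
proof -
  define d where "d = bdist \<Omega> x"
  have d: "0 < d" using bdist_pos[OF open_\<Omega> bounded_\<Omega> x] by (simp add: d_def)
  define s where "s = \<eta> * d"
  have s: "0 < s" using d \<eta> by (simp add: s_def)
  have 2: "2 * s \<le> d / 2" using \<eta> d by (simp add: s_def)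
  \<comment> \<open>The scale is \<open>d / 2\<close> and the radius \<open>2 * s\<close>, which
    gives the ratio \<open>4 * \<eta>\<close> and the factor \<open>4\<close>. The ratio is at most
    \<open>1\<close>, so lowering the exponent to \<open>am\<close> enlarges the power.\<close>
  have "\<bar>double_diff i j s u x / s\<^sup>2 - D [i, j] u x\<bar> \<le> S * (2 * s / (d / 2)) powr \<alpha> x / (d / 2)\<^sup>2"
    by (rule double_diff_holder) (use d s 2 x in \<open>auto simp: d_def\<close>)
  also have "\<dots> = 4 * S * (4 * \<eta>) powr \<alpha> x / d\<^sup>2"
    using d by (simp add: s_def field_simps power2_eq_square)
  also have "\<dots> \<le> 4 * S * (4 * \<eta>) powr am / d\<^sup>2"
    using S \<eta> exponent[OF x] by (intro divide_right_mono mult_left_mono powr_mono') auto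
  finally have 1: "\<bar>double_diff i j s u x / s\<^sup>2 - D [i, j] u x\<bar> \<le> 4 * S * (4 * \<eta>) powr am / d\<^sup>2" .
  have "z \<in> \<Omega>" if "z \<in> cball x (2 * s)" for z
    using near[OF x, of "d / 2" z] that d 2 by (simp add: d_def)
  note mem = this[OF axis_steps]
  have "\<bar>double_diff i j s u x\<bar> \<le> 4 * U0"
    using U0[OF x] U0[OF mem[of s s j i]] U0[OF mem[of s 0 j]] U0[OF mem[of 0 s _ i]] s
    unfolding double_diff_def by simp
  then have "\<bar>double_diff i j s u x / s\<^sup>2\<bar> \<le> 4 * U0 / s\<^sup>2"
    using s by (simp add: divide_right_mono)
  then have "\<bar>D [i, j] u x\<bar> \<le> 4 * U0 / s\<^sup>2 + 4 * S * (4 * \<eta>) powr am / d\<^sup>2"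
    using 1 by linarith
  then have "d\<^sup>2 * \<bar>D [i, j] u x\<bar> \<le> d\<^sup>2 * (4 * U0 / s\<^sup>2 + 4 * S * (4 * \<eta>) powr am / d\<^sup>2)"
    by (rule mult_left_mono) simp
  also have "\<dots> = 4 * U0 / \<eta>\<^sup>2 + 4 * S * (4 * \<eta>) powr am"
    using d \<eta> by (simp add: s_def field_simps power2_eq_square)
  finally show ?thesis by (simp add: d_def)
qed

text \<open>On a segment of half the boundary distance, some point has first derivative bounded by
  the oscillation of \<open>u\<close>; returning to \<open>x\<close> along the segment costs one
  second derivative.\<close>

lemma interpolation_1:
  assumes x: "x \<in> \<Omega>" and U2: "\<And>y i j. y \<in> \<Omega> \<Longrightarrow> (bdist \<Omega> y)\<^sup>2 * \<bar>D [i, j] u y\<bar> \<le> U2"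
  shows "bdist \<Omega> x * \<bar>D [i] u x\<bar> \<le> 4 * U0 + 2 * U2"
proof -
  define d where "d = bdist \<Omega> x"
  have d: "0 < d" using bdist_pos[OF open_\<Omega> bounded_\<Omega> x] by (simp add: d_def)
  define s where "s = d / 2"
  have s: "0 < s" "2 * s \<le> bdist \<Omega> x" using d by (simp_all add: s_def d_def)
  have line: "x + (t * a) *\<^sub>R axis i 1 \<in> \<Omega>" "s \<le> bdist \<Omega> (x + (t * a) *\<^sub>R axis i 1)"
    if "0 \<le> t" "t \<le> 1" "0 \<le> a" "a \<le> s" for t a
  proof -
    have "t * a \<le> 1 * s" using that by (intro mult_mono) auto
    then have "dist x (x + (t * a) *\<^sub>R axis i 1) \<le> s" using that by (simp add: dist_norm abs_mult)
    then show "x + (t * a) *\<^sub>R axis i 1 \<in> \<Omega>" "s \<le> bdist \<Omega> (x + (t * a) *\<^sub>R axis i 1)"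
      using near[OF x s] by blast+
  qed
  obtain t where t: "0 < t" "t < 1"
    and 1: "u (x + s *\<^sub>R axis i 1) - u x = s * partial_deriv i u (x + (t * s) *\<^sub>R axis i 1)"
    by (rule partial_mvt[of i u x s]) (use line s partials in auto)
  have ts: "0 \<le> t * s" "t * s \<le> s" using t s by (auto simp: mult_left_le_one_le)
  obtain t' where t': "0 < t'" "t' < 1"
    and 2: "D [i] u (x + (t * s) *\<^sub>R axis i 1) - D [i] u x
       = (t * s) * partial_deriv i (D [i] u) (x + (t' * (t * s)) *\<^sub>R axis i 1)"
    by (rule partial_mvt[of i "D [i] u" x "t * s"]) (use line[OF _ _ ts] partials in auto)
  let ?y = "x + (t' * (t * s)) *\<^sub>R axis i 1"
  have y: "?y \<in> \<Omega>" "s \<le> bdist \<Omega> ?y" using line[OF _ _ ts, of t'] t' by auto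
  have "s\<^sup>2 * \<bar>D [i, i] u ?y\<bar> \<le> (bdist \<Omega> ?y)\<^sup>2 * \<bar>D [i, i] u ?y\<bar>"
    using y s by (intro mult_right_mono power_mono) auto
  also have "\<dots> \<le> U2" by (rule U2[OF y(1)])
  finally have 3: "s\<^sup>2 * \<bar>D [i, i] u ?y\<bar> \<le> U2" .
  have "s * \<bar>D [i] u (x + (t * s) *\<^sub>R axis i 1) - D [i] u x\<bar> \<le> s\<^sup>2 * \<bar>D [i, i] u ?y\<bar>"
    using 2 s t ts mult_right_mono[OF ts(2), of "\<bar>D [i, i] u ?y\<bar>"]
    by (simp add: D_simps abs_mult power2_eq_square mult.assoc)
  then have 4: "s * \<bar>D [i] u (x + (t * s) *\<^sub>R axis i 1) - D [i] u x\<bar> \<le> U2" using 3 by linarith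
  have "s * \<bar>D [i] u (x + (t * s) *\<^sub>R axis i 1)\<bar> = \<bar>u (x + s *\<^sub>R axis i 1) - u x\<bar>"
    using 1 s by (simp add: D_simps abs_mult)
  also have "\<dots> \<le> 2 * U0"
    using U0[OF x] U0[OF line(1)[of 1 s]] s by simp
  finally have 5: "s * \<bar>D [i] u (x + (t * s) *\<^sub>R axis i 1)\<bar> \<le> 2 * U0" .
  have "s * \<bar>D [i] u x\<bar> \<le> s * (\<bar>D [i] u (x + (t * s) *\<^sub>R axis i 1)\<bar> + \<bar>D [i] u (x + (t * s) *\<^sub>R axis i 1) - D [i] u x\<bar>)"
    using s by (intro mult_left_mono) auto
  also have "\<dots> \<le> 2 * U0 + U2" using 4 5 by (simp add: distrib_left)
  finally show ?thesis by (simp add: s_def d_def)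
qed

end

section \<open>Freezing the coefficients\<close>

text \<open>The ratio of the two powers is the exponential of
  \<open>(q - p) * (ln r - ln \<delta>)\<close>. The hypothesis controls \<open>ln r\<close>; if
  \<open>\<delta> \<le> 1\<close> then \<open>ln \<delta>\<close> is smaller in absolute value, and
  otherwise it is at most \<open>ln K\<close>, which accounts for \<open>max 1 K\<close>.\<close>

lemma powr_log_holder_compare:
  fixes r \<delta> p q :: real
  assumes r: "0 < r" "r \<le> \<delta>" and \<delta>: "\<delta> \<le> K"
    and pq: "\<bar>p - q\<bar> \<le> 1" and M: "\<bar>ln r\<bar> * \<bar>p - q\<bar> \<le> M"
  shows "(r / \<delta>) powr q \<le> exp (2 * M) * max 1 K * (r / \<delta>) powr p"
proof -
  have \<delta>0: "0 < \<delta>" using r by linarith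
  have 1: "\<bar>ln \<delta>\<bar> * \<bar>p - q\<bar> \<le> M + ln (max 1 K)"
  proof (cases "\<delta> \<le> 1")
    case True
    then have "\<bar>ln \<delta>\<bar> \<le> \<bar>ln r\<bar>" using r \<delta>0 by simp
    then have "\<bar>ln \<delta>\<bar> * \<bar>p - q\<bar> \<le> \<bar>ln r\<bar> * \<bar>p - q\<bar>" by (rule mult_right_mono) simp
    moreover have "0 \<le> ln (max 1 K)" by simp
    ultimately show ?thesis using M by linarith
  next
    case False
    then have "\<bar>ln \<delta>\<bar> * \<bar>p - q\<bar> \<le> ln \<delta> * 1" using pq by (intro mult_mono) auto
    moreover have "ln \<delta> \<le> ln (max 1 K)" using False \<delta> by simp
    moreover have "0 \<le> M" using M by (meson abs_ge_zero mult_nonneg_nonneg order_trans)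
    ultimately show ?thesis by linarith
  qed
  have "(q - p) * (ln r - ln \<delta>) \<le> \<bar>(q - p) * (ln r - ln \<delta>)\<bar>" by simp
  also have "\<dots> = \<bar>p - q\<bar> * \<bar>ln r - ln \<delta>\<bar>" by (simp add: abs_mult abs_minus_commute)
  also have "\<dots> \<le> \<bar>p - q\<bar> * (\<bar>ln r\<bar> + \<bar>ln \<delta>\<bar>)"
    by (intro mult_left_mono) auto
  also have "\<dots> \<le> 2 * M + ln (max 1 K)" using 1 M by (simp add: algebra_simps)
  finally have "exp ((q - p) * (ln r - ln \<delta>)) \<le> exp (2 * M + ln (max 1 K))" by simp
  then have "(r / \<delta>) powr (q - p) \<le> exp (2 * M) * max 1 K"
    using r \<delta>0 by (simp add: powr_def ln_div exp_add)
  then have "(r / \<delta>) powr p * (r / \<delta>) powr (q - p) \<le> (r / \<delta>) powr p * (exp (2 * M) * max 1 K)"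
    by (rule mult_left_mono) simp
  then show ?thesis using r \<delta>0 by (simp add: powr_add[symmetric] mult_ac)
qed

context interior_C2
begin

lemma weighted_near:
  assumes h: "\<And>x y. x \<in> \<Omega> \<Longrightarrow> y \<in> \<Omega> \<Longrightarrow> x \<noteq> y \<Longrightarrow>
      bdist2 \<Omega> x y powr (s + \<alpha> x) * (\<bar>g x - g y\<bar> / norm (x - y) powr \<alpha> x) \<le> K"
    and s: "0 \<le> s" and K: "0 \<le> K"
    and x: "x \<in> \<Omega>" and \<delta>: "0 < \<delta>" "2 * \<delta> \<le> bdist \<Omega> x" and r: "r \<le> \<delta>" and y: "dist x y \<le> r"
  shows "\<bar>g x - g y\<bar> \<le> K * (r / \<delta>) powr \<alpha> x / \<delta> powr s"
proof (cases "x = y")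
  case False
  show ?thesis
    by (rule weighted_quotient_bound[OF h[of x y]])
      (use assms False near[OF x \<delta>, of y] alpha_pos[OF x] in \<open>auto simp: dist_norm\<close>)
qed (use K in simp)

end

text \<open>The weights 0, 1, 2 on \<open>a\<close>, \<open>b\<close>, \<open>c\<close> complement
  the orders of the derivatives they multiply, so that on scale \<delta> every term of the equation
  carries the same factor \<open>1 / \<delta>\<^sup>2\<close>.\<close>

locale elliptic_eq = interior_C2 \<Omega> \<alpha> u S U0 am
  for \<Omega> :: "(real^'n) set" and \<alpha> u S U0 am +
  fixes a :: "'n \<Rightarrow> 'n \<Rightarrow> real^'n \<Rightarrow> real" and b :: "'n \<Rightarrow> real^'n \<Rightarrow> real" and c f :: "real^'n \<Rightarrow> real"
    and \<Lambda> l F0 :: real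
  assumes l: "0 < l" and \<Lambda>: "0 \<le> \<Lambda>" and F0: "0 \<le> F0"
    and equation: "\<And>x. x \<in> \<Omega> \<Longrightarrow> elliptic_op a b c u x = f x"
    and elliptic: "\<And>x \<zeta>. x \<in> \<Omega> \<Longrightarrow> l * (norm \<zeta>)\<^sup>2 \<le> (\<Sum>i\<in>UNIV. \<Sum>j\<in>UNIV. a i j x * \<zeta> $ i * \<zeta> $ j)"
    and a_bound: "\<And>i j x. x \<in> \<Omega> \<Longrightarrow> \<bar>a i j x\<bar> \<le> \<Lambda>"
    and a_holder: "\<And>i j x y. x \<in> \<Omega> \<Longrightarrow> y \<in> \<Omega> \<Longrightarrow> x \<noteq> y \<Longrightarrow>
      bdist2 \<Omega> x y powr (0 + \<alpha> x) * (\<bar>a i j x - a i j y\<bar> / norm (x - y) powr \<alpha> x) \<le> \<Lambda>"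
    and b_bound: "\<And>i x. x \<in> \<Omega> \<Longrightarrow> bdist \<Omega> x * \<bar>b i x\<bar> \<le> \<Lambda>"
    and b_holder: "\<And>i x y. x \<in> \<Omega> \<Longrightarrow> y \<in> \<Omega> \<Longrightarrow> x \<noteq> y \<Longrightarrow>
      bdist2 \<Omega> x y powr (1 + \<alpha> x) * (\<bar>b i x - b i y\<bar> / norm (x - y) powr \<alpha> x) \<le> \<Lambda>"
    and c_bound: "\<And>x. x \<in> \<Omega> \<Longrightarrow> (bdist \<Omega> x)\<^sup>2 * \<bar>c x\<bar> \<le> \<Lambda>"
    and c_holder: "\<And>x y. x \<in> \<Omega> \<Longrightarrow> y \<in> \<Omega> \<Longrightarrow> x \<noteq> y \<Longrightarrow>
      bdist2 \<Omega> x y powr (2 + \<alpha> x) * (\<bar>c x - c y\<bar> / norm (x - y) powr \<alpha> x) \<le> \<Lambda>"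
    and f_holder: "\<And>x y. x \<in> \<Omega> \<Longrightarrow> y \<in> \<Omega> \<Longrightarrow> x \<noteq> y \<Longrightarrow>
      bdist2 \<Omega> x y powr (2 + \<alpha> x) * (\<bar>f x - f y\<bar> / norm (x - y) powr \<alpha> x) \<le> F0"

text \<open>\<open>U1\<close> and \<open>U2\<close> stay parameters while the equation is frozen;
  interpolation gives them values only at the absorption.\<close>

locale elliptic_C2 = elliptic_eq \<Omega> \<alpha> u S U0 am a b c f \<Lambda> l F0
  for \<Omega> :: "(real^'n) set" and \<alpha> u S U0 am a b c f \<Lambda> l F0 +
  fixes U1 U2 :: real
  assumes U1: "\<And>x i. x \<in> \<Omega> \<Longrightarrow> bdist \<Omega> x * \<bar>D [i] u x\<bar> \<le> U1"
    and U2: "\<And>x i j. x \<in> \<Omega> \<Longrightarrow> (bdist \<Omega> x)\<^sup>2 * \<bar>D [i, j] u x\<bar> \<le> U2"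
begin

definition n :: real where "n = real CARD('n)"

text \<open>The total of the error terms in \<open>principal_part_osc\<close>. The \<open>U2\<close>
  term comes half from the oscillation of \<open>a\<close> and half from \<open>b\<close> times that
  of the gradient; the \<open>U1\<close> term half from the oscillation of \<open>b\<close> and half
  from \<open>c\<close> times that of \<open>u\<close>.\<close>

definition \<kappa> :: real where "\<kappa> = F0 + 2 * n\<^sup>2 * \<Lambda> * U2 + 2 * n * \<Lambda> * U1 + \<Lambda> * U0"

definition A :: "real^'n \<Rightarrow> real^'n^'n" where "A x = (\<chi> i j. a i j x)"

definition H :: "real^'n \<Rightarrow> real^'n^'n" where "H x = (\<chi> i j. D [i, j] u x)"

lemma A_inner_H: "A x \<bullet> H y = (\<Sum>i\<in>UNIV. \<Sum>j\<in>UNIV. a i j x * D [i, j] u y)"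
  by (simp add: A_def H_def inner_vec_def)

lemma principal_part_osc:
  assumes x: "x \<in> \<Omega>" and \<delta>: "0 < \<delta>" "2 * \<delta> \<le> bdist \<Omega> x" and R: "R \<le> \<delta>" and y: "dist x y \<le> R"
  shows "\<bar>A x \<bullet> H y - A x \<bullet> H x\<bar> \<le> \<kappa> * (R / \<delta>) powr \<alpha> x / \<delta>\<^sup>2"
proof -
  define Q where "Q = (R / \<delta>) powr \<alpha> x"
  define W where "W = Q / \<delta>\<^sup>2"
  have R0: "0 \<le> R" using y zero_le_dist[of x y] by linarith
  \<comment> \<open>The ratio and the exponent are at most \<open>1\<close>, so Lipschitz errors in
    \<open>u\<close> and its gradient are dominated by the Hoelder factor \<open>Q\<close>.\<close>
  have "R / \<delta> = (R / \<delta>) powr 1" using R0 \<delta> by simp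
  also have "\<dots> \<le> Q"
    unfolding Q_def using R0 R \<delta> exponent[OF x] by (intro powr_mono') auto
  finally have RQ: "R / \<delta> \<le> Q" .
  have Q0: "0 \<le> Q" by (simp add: Q_def)
  have ball: "cball x R \<subseteq> \<Omega>" using near[OF x \<delta>] R by force
  have yb: "y \<in> \<Omega>" "\<delta> \<le> bdist \<Omega> y" using near[OF x \<delta>, of y] y R by auto
  have scale1: "\<bar>g\<bar> \<le> K / \<delta>" if "bdist \<Omega> z * \<bar>g\<bar> \<le> K" "dist x z \<le> R" for g K z
  proof -
    have "\<delta> * \<bar>g\<bar> \<le> bdist \<Omega> z * \<bar>g\<bar>"
      using near[OF x \<delta>, of z] that R by (intro mult_right_mono) auto
    then show ?thesis using that \<delta> by (simp add: field_simps)
  qed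
  have scale2: "\<bar>g\<bar> \<le> K / \<delta>\<^sup>2" if "(bdist \<Omega> z)\<^sup>2 * \<bar>g\<bar> \<le> K" "dist x z \<le> R" for g K z
  proof -
    have "\<delta>\<^sup>2 * \<bar>g\<bar> \<le> (bdist \<Omega> z)\<^sup>2 * \<bar>g\<bar>"
      using near[OF x \<delta>, of z] that R \<delta> by (intro mult_right_mono power_mono) auto
    then show ?thesis using that \<delta> by (simp add: field_simps)
  qed
  have xx: "dist x x \<le> R" using R0 by simp
  have U1x: "\<bar>D [i] u z\<bar> \<le> U1 / \<delta>" if "dist x z \<le> R" for i z
    using scale1[OF U1 that] ball that by auto
  have U2x: "\<bar>D [i, j] u z\<bar> \<le> U2 / \<delta>\<^sup>2" if "dist x z \<le> R" for i j z
    using scale2[OF U2 that] ball that by auto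
  have U10: "0 \<le> U1 / \<delta>" and U20: "0 \<le> U2 / \<delta>\<^sup>2" and U00: "0 \<le> U0"
    using order_trans[OF abs_ge_zero U1x[OF xx]] order_trans[OF abs_ge_zero U2x[OF xx]]
      order_trans[OF abs_ge_zero U0[OF x]] by auto
  have dDu: "\<bar>D [i] u y - D [i] u x\<bar> \<le> n * (U2 / \<delta>\<^sup>2) * R" for i
    unfolding n_def
    by (rule lipschitz_from_partials[OF open_\<Omega> ball])
      (use partials U2x y in \<open>auto simp: D_simps\<close>)
  have du: "\<bar>u y - u x\<bar> \<le> n * (U1 / \<delta>) * R"
    unfolding n_def
    by (rule lipschitz_from_partials[OF open_\<Omega> ball])
      (use partials U1x y in \<open>auto simp: D_simps\<close>)
  note osc = weighted_near[OF _ _ _ x \<delta> R y, folded Q_def]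
  have da: "\<bar>a i j x - a i j y\<bar> \<le> \<Lambda> * Q" for i j
    using osc[of 0 "a i j", OF a_holder] \<Lambda> \<delta> by simp
  have db: "\<bar>b i x - b i y\<bar> \<le> \<Lambda> * Q / \<delta>" for i
    using osc[of 1 "b i", OF b_holder] \<Lambda> \<delta> by simp
  have dc: "\<bar>c x - c y\<bar> \<le> \<Lambda> * Q / \<delta>\<^sup>2"
    using osc[of 2 c, OF c_holder] \<Lambda> \<delta> by (simp add: powr_numeral)
  have df: "\<bar>f x - f y\<bar> \<le> F0 * W"
    using osc[of 2 f, OF f_holder] F0 \<delta> by (simp add: powr_numeral W_def)
  have RQ': "R \<le> \<delta> * Q" using RQ \<delta> by (simp add: field_simps)
  have nn: "0 \<le> n" by (simp add: n_def)
  have T2: "\<bar>(a i j x - a i j y) * D [i, j] u y\<bar> \<le> \<Lambda> * U2 * W" for i j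
  proof -
    have "\<bar>(a i j x - a i j y) * D [i, j] u y\<bar> \<le> (\<Lambda> * Q) * (U2 / \<delta>\<^sup>2)"
      unfolding abs_mult using da U2x[OF y] Q0 \<Lambda> by (intro mult_mono) auto
    then show ?thesis by (simp add: W_def mult_ac)
  qed
  have T3: "\<bar>b i x * D [i] u x - b i y * D [i] u y\<bar> \<le> (\<Lambda> * U1 + \<Lambda> * n * U2) * W" for i
  proof -
    have "\<bar>(b i x - b i y) * D [i] u y\<bar> \<le> (\<Lambda> * Q / \<delta>) * (U1 / \<delta>)"
      unfolding abs_mult using db U1x[OF y] Q0 \<Lambda> \<delta> by (intro mult_mono) auto
    moreover have "\<bar>b i x * (D [i] u y - D [i] u x)\<bar> \<le> (\<Lambda> / \<delta>) * (n * (U2 / \<delta>\<^sup>2) * (\<delta> * Q))"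
    proof -
      have "n * (U2 / \<delta>\<^sup>2) * R \<le> n * (U2 / \<delta>\<^sup>2) * (\<delta> * Q)"
        by (rule mult_left_mono[OF RQ' mult_nonneg_nonneg[OF nn U20]])
      then have "\<bar>D [i] u y - D [i] u x\<bar> \<le> n * (U2 / \<delta>\<^sup>2) * (\<delta> * Q)" using dDu[of i] by linarith
      then show ?thesis
        unfolding abs_mult using scale1[OF b_bound[OF x] xx] \<Lambda> \<delta> by (intro mult_mono) auto
    qed
    moreover have "b i x * D [i] u x - b i y * D [i] u y
        = (b i x - b i y) * D [i] u y - b i x * (D [i] u y - D [i] u x)"
      by (simp add: algebra_simps)
    ultimately have "\<bar>b i x * D [i] u x - b i y * D [i] u y\<bar>
       \<le> (\<Lambda> * Q / \<delta>) * (U1 / \<delta>) + (\<Lambda> / \<delta>) * (n * (U2 / \<delta>\<^sup>2) * (\<delta> * Q))"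
      by linarith
    also have "\<dots> = (\<Lambda> * U1 + \<Lambda> * n * U2) * W"
      using \<delta> by (simp add: W_def field_simps power2_eq_square)
    finally show ?thesis .
  qed
  have T4: "\<bar>c x * u x - c y * u y\<bar> \<le> (\<Lambda> * U0 + \<Lambda> * n * U1) * W"
  proof -
    have "\<bar>(c x - c y) * u y\<bar> \<le> (\<Lambda> * Q / \<delta>\<^sup>2) * U0"
      unfolding abs_mult using dc U0[OF yb(1)] Q0 \<Lambda> \<delta> by (intro mult_mono) auto
    moreover have "\<bar>c x * (u y - u x)\<bar> \<le> (\<Lambda> / \<delta>\<^sup>2) * (n * (U1 / \<delta>) * (\<delta> * Q))"
    proof -
      have "n * (U1 / \<delta>) * R \<le> n * (U1 / \<delta>) * (\<delta> * Q)"
        by (rule mult_left_mono[OF RQ' mult_nonneg_nonneg[OF nn U10]])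
      then have "\<bar>u y - u x\<bar> \<le> n * (U1 / \<delta>) * (\<delta> * Q)" using du by linarith
      then show ?thesis
        unfolding abs_mult using scale2[OF c_bound[OF x] xx] \<Lambda> \<delta> by (intro mult_mono) auto
    qed
    moreover have "c x * u x - c y * u y = (c x - c y) * u y - c x * (u y - u x)"
      by (simp add: algebra_simps)
    ultimately have "\<bar>c x * u x - c y * u y\<bar>
       \<le> (\<Lambda> * Q / \<delta>\<^sup>2) * U0 + (\<Lambda> / \<delta>\<^sup>2) * (n * (U1 / \<delta>) * (\<delta> * Q))"
      by linarith
    also have "\<dots> = (\<Lambda> * U0 + \<Lambda> * n * U1) * W"
      using \<delta> by (simp add: W_def field_simps power2_eq_square)
    finally show ?thesis .
  qed
  have eq: "f z = A z \<bullet> H z + (\<Sum>i\<in>UNIV. b i z * D [i] u z) + c z * u z" if "z \<in> \<Omega>" for z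
    using equation[OF that] by (simp add: elliptic_op_def A_inner_H)
  have diffA: "A x \<bullet> H y - A y \<bullet> H y = (\<Sum>i\<in>UNIV. \<Sum>j\<in>UNIV. (a i j x - a i j y) * D [i, j] u y)"
    by (simp add: A_inner_H left_diff_distrib sum_subtractf)
  \<comment> \<open>Subtract the equations at \<open>x\<close> and \<open>y\<close> and move the
    coefficients of the second-order part from \<open>y\<close> to \<open>x\<close>.\<close>
  have "A x \<bullet> H y - A x \<bullet> H x = (\<Sum>i\<in>UNIV. \<Sum>j\<in>UNIV. (a i j x - a i j y) * D [i, j] u y)
      + (\<Sum>i\<in>UNIV. b i x * D [i] u x - b i y * D [i] u y) + (c x * u x - c y * u y) - (f x - f y)"
    using eq[OF x] eq[OF yb(1)] diffA by (simp add: sum_subtractf)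
  moreover have "\<bar>\<Sum>i\<in>UNIV. \<Sum>j\<in>UNIV. (a i j x - a i j y) * D [i, j] u y\<bar> \<le> n * (n * (\<Lambda> * U2 * W))"
  proof -
    have "\<bar>\<Sum>j\<in>UNIV. (a i j x - a i j y) * D [i, j] u y\<bar> \<le> n * (\<Lambda> * U2 * W)" for i
      using sum_norm_bound[of UNIV "\<lambda>j. (a i j x - a i j y) * D [i, j] u y", OF T2[unfolded real_norm_def[symmetric]]]
      by (simp add: n_def)
    then show ?thesis
      using sum_norm_bound[of UNIV "\<lambda>i. \<Sum>j\<in>UNIV. (a i j x - a i j y) * D [i, j] u y" "n * (\<Lambda> * U2 * W)"]
      by (simp add: n_def)
  qed
  moreover have "\<bar>\<Sum>i\<in>UNIV. b i x * D [i] u x - b i y * D [i] u y\<bar> \<le> n * ((\<Lambda> * U1 + \<Lambda> * n * U2) * W)"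
    using sum_norm_bound[of UNIV "\<lambda>i. b i x * D [i] u x - b i y * D [i] u y" "(\<Lambda> * U1 + \<Lambda> * n * U2) * W"] T3
    by (simp add: n_def)
  ultimately have "\<bar>A x \<bullet> H y - A x \<bullet> H x\<bar> \<le> n * (n * (\<Lambda> * U2 * W))
      + n * ((\<Lambda> * U1 + \<Lambda> * n * U2) * W) + (\<Lambda> * U0 + \<Lambda> * n * U1) * W + F0 * W"
    using T4 df by linarith
  also have "\<dots> = \<kappa> * W" by (simp add: \<kappa>_def algebra_simps power2_eq_square)
  finally show ?thesis by (simp add: W_def Q_def)
qed

text \<open>The first two terms are \<open>difference_bound\<close> for the double difference; the
  last is the error of replacing double differences by derivatives at \<open>x\<close> and at
  \<open>y\<close>. Only the one at \<open>y\<close> brings in \<open>\<alpha> y\<close>, converted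
  by \<open>E\<close>.\<close>

lemma second_derivative_difference:
  assumes x: "x \<in> \<Omega>" and y: "y \<in> \<Omega>" and xy: "x \<noteq> y"
    and \<delta>: "0 < \<delta>" "2 * \<delta> \<le> bdist2 \<Omega> x y" and N: "4 \<le> N" "N * norm (x - y) \<le> \<delta>"
    and \<epsilon>: "0 < \<epsilon>" "\<epsilon> \<le> 1 / 4" and ap: "\<alpha> x \<le> ap"
    and E: "(norm (x - y) / \<delta>) powr \<alpha> y \<le> E * (norm (x - y) / \<delta>) powr \<alpha> x"
  shows "\<bar>D [i, j] u x - D [i, j] u y\<bar> \<le> (norm (x - y) / \<delta>) powr \<alpha> x / \<delta>\<^sup>2 *
     (16 * (1 + n * \<Lambda> / l) * N powr (ap - 1) * S + N powr (1 + ap) * \<kappa> / (2 * l * \<epsilon>\<^sup>2)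
        + (1 + E) * (2 * \<epsilon>) powr am * S)"
proof -
  define r where "r = norm (x - y)"
  \<comment> \<open>\<open>s\<close> is the step of the differences, \<open>R\<close> the radius
    around \<open>x\<close> containing every point used, and \<rho> the radius around the midpoint
    \<open>z\<close>. Since \<open>4 \<le> N\<close>, the points \<open>x\<close> and
    \<open>y\<close> are at most \<rho> apart, and the ball around \<open>z\<close> together with
    all steps fits into radius \<open>R\<close>.\<close>
  define s where "s = \<epsilon> * r"
  define R where "R = N * r"
  define \<rho> where "\<rho> = R / 4"
  define z where "z = (1/2) *\<^sub>R (x + y)"
  define q where "q = (r / \<delta>) powr \<alpha> x"
  define Q where "Q = (R / \<delta>) powr \<alpha> x"
  have r: "0 < r" using xy by (simp add: r_def)
  have s: "0 < s" "2 * s \<le> r / 2"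
    using r \<epsilon> mult_right_mono[OF \<epsilon>(2), of r] by (simp_all add: s_def)
  have R: "4 * r \<le> R" "R \<le> \<delta>" "0 < R"
    using N r mult_right_mono[OF N(1), of r] mult_pos_pos[of N r] by (simp_all add: R_def r_def)
  have \<rho>: "0 < \<rho>" "r \<le> \<rho>" using R by (simp_all add: \<rho>_def)
  have \<delta>x: "2 * \<delta> \<le> bdist \<Omega> x" and \<delta>y: "2 * \<delta> \<le> bdist \<Omega> y" using \<delta> by (auto simp: bdist2_def)
  have n0: "0 \<le> n" by (simp add: n_def)
  have xz: "dist x z = r / 2" and yz: "dist z y = r / 2"
  proof -
    have "x - z = (1/2) *\<^sub>R (x - y)" "z - y = (1/2) *\<^sub>R (x - y)"
      by (simp_all add: z_def vec_eq_iff field_simps)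
    then show "dist x z = r / 2" "dist z y = r / 2" by (simp_all add: dist_norm r_def)
  qed
  have inR: "dist x p + 2 * s \<le> R" if "p \<in> cball z \<rho>" for p
  proof -
    have "dist x p \<le> dist x z + dist z p" by (rule dist_triangle)
    also have "\<dots> \<le> r / 2 + R / 4" using that xz by (simp add: \<rho>_def)
    finally show ?thesis using s R by linarith
  qed
  have sub: "cball p (2 * s) \<subseteq> \<Omega>" if "p \<in> cball z \<rho>" for p
  proof
    fix p' assume "p' \<in> cball p (2 * s)"
    then have "dist x p' \<le> \<delta>" using inR[OF that] dist_triangle[of x p' p] R by simp
    then show "p' \<in> \<Omega>" using near[OF x \<delta>(1) \<delta>x] by blast
  qed
  define G where "G = (\<lambda>x. \<chi> i. D [i] u x)"
  have C2u: "C2_on \<Omega> u G H"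
    using C_open_imp_C2_on[OF u open_\<Omega>] unfolding G_def H_def .
  \<comment> \<open>Subtracting a constant leaves the Hessian unchanged and makes the supremum of
    \<open>w\<close> an oscillation of \<open>D [i, j] u\<close> about \<open>x\<close>.\<close>
  define w where "w = (\<lambda>p. double_diff i j s u p - s\<^sup>2 * D [i, j] u x)"
  have C2w: "C2_on (cball z \<rho>) w (\<lambda>p. double_diff i j s G p - 0) (\<lambda>p. double_diff i j s H p - 0)"
    unfolding w_def using s by (intro C2_on_diff C2_on_const C2_on_double_diff[OF C2u sub]) auto
  have w_bound: "\<bar>w p\<bar> \<le> s\<^sup>2 * (S * Q / \<delta>\<^sup>2)" if "p \<in> cball z \<rho>" for p
  proof -
    have "\<bar>double_diff i j s u p / s\<^sup>2 - D [i, j] u x\<bar> \<le> S * Q / \<delta>\<^sup>2"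
      unfolding Q_def by (rule double_diff_holder[OF x \<delta>(1) \<delta>x s(1) R(2) inR[OF that]])
    then have "s\<^sup>2 * \<bar>double_diff i j s u p / s\<^sup>2 - D [i, j] u x\<bar> \<le> s\<^sup>2 * (S * Q / \<delta>\<^sup>2)"
      by (rule mult_left_mono) simp
    also have "s\<^sup>2 * \<bar>double_diff i j s u p / s\<^sup>2 - D [i, j] u x\<bar> = \<bar>w p\<bar>"
    proof -
      have "w p = s\<^sup>2 * (double_diff i j s u p / s\<^sup>2 - D [i, j] u x)"
        using s by (simp add: w_def right_diff_distrib)
      then show ?thesis by (simp add: abs_mult)
    qed
    finally show ?thesis .
  qed
  have Lw_bound: "\<bar>A x \<bullet> (double_diff i j s H p - 0)\<bar> \<le> 4 * (\<kappa> * Q / \<delta>\<^sup>2)" if p: "p \<in> cball z \<rho>" for p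
  proof -
    have *: "\<bar>A x \<bullet> H (p + a *\<^sub>R axis j 1 + b *\<^sub>R axis i 1) - A x \<bullet> H x\<bar> \<le> \<kappa> * Q / \<delta>\<^sup>2"
      if "0 \<le> a" "a \<le> s" "0 \<le> b" "b \<le> s" for a b
    proof -
      have "dist x (p + a *\<^sub>R axis j 1 + b *\<^sub>R axis i 1) \<le> R"
        using axis_steps[OF that, of p j i] inR[OF p] dist_triangle[of x "p + a *\<^sub>R axis j 1 + b *\<^sub>R axis i 1" p]
        by simp
      then show ?thesis unfolding Q_def by (rule principal_part_osc[OF x \<delta>(1) \<delta>x R(2)])
    qed
    \<comment> \<open>The alternating sum of the four corner values cancels the common reference
      value, here \<open>A x \<bullet> H x\<close>.\<close>
    have four: "\<bar>h1 - h2 - (h3 - h4)\<bar> \<le> 4 * K"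
      if "\<bar>h1 - g\<bar> \<le> K" "\<bar>h2 - g\<bar> \<le> K" "\<bar>h3 - g\<bar> \<le> K" "\<bar>h4 - g\<bar> \<le> K" for h1 h2 h3 h4 g K :: real
      using that by linarith
    show ?thesis
      using four[OF *[of s s] *[of s 0] *[of 0 s] *[of 0 0]] s
      by (simp add: double_diff_def inner_diff_right)
  qed
  have tr: "A x \<bullet> mat 1 \<le> n * \<Lambda>"
  proof -
    have "A x \<bullet> mat 1 \<le> (\<Sum>i\<in>(UNIV::'n set). \<Lambda>)"
      unfolding inner_mat_1 using a_bound[OF x] by (intro sum_mono) (auto simp: A_def intro: order_trans[OF abs_ge_self])
    then show ?thesis by (simp add: n_def)
  qed
  have ell: "l * (norm \<zeta>)\<^sup>2 \<le> \<zeta> \<bullet> (A x *v \<zeta>)" for \<zeta>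
    using elliptic[OF x, of \<zeta>]
    by (simp add: A_def inner_vec_def matrix_vector_mult_def sum_distrib_left mult_ac)
  have "\<bar>w x - w y\<bar> \<le> (norm (x - y) / \<rho>) *
      (4 * (1 + n * \<Lambda> / l) * (s\<^sup>2 * (S * Q / \<delta>\<^sup>2)) + \<rho>\<^sup>2 * (4 * (\<kappa> * Q / \<delta>\<^sup>2)) / (2 * l))"
    by (rule difference_bound[OF C2w order_refl \<rho>(1) l ell tr w_bound Lw_bound])
      (use \<rho> in \<open>auto simp: z_def r_def\<close>)
  also have "\<dots> = s\<^sup>2 * (Q / \<delta>\<^sup>2 * (16 * (1 + n * \<Lambda> / l) / N * S + N * \<kappa> / (2 * l * \<epsilon>\<^sup>2)))"
  proof -
    have 1: "norm (x - y) / \<rho> = 4 / N" using r N by (simp add: \<rho>_def R_def r_def)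
    have 2: "\<rho>\<^sup>2 = s\<^sup>2 * (N\<^sup>2 / (16 * \<epsilon>\<^sup>2))"
      using \<epsilon> by (simp add: \<rho>_def R_def s_def field_simps power2_eq_square)
    define g where "g = 1 + n * \<Lambda> / l"
    show ?thesis
      unfolding g_def[symmetric] 1 2 using N(1) l \<epsilon> \<delta>(1)
      by (simp add: field_simps power2_eq_square)
  qed
  finally have w_diff: "\<bar>w x - w y\<bar> / s\<^sup>2 \<le> Q / \<delta>\<^sup>2 * (16 * (1 + n * \<Lambda> / l) / N * S + N * \<kappa> / (2 * l * \<epsilon>\<^sup>2))"
    using s by (simp add: field_simps)
  have \<kappa>0: "0 \<le> \<kappa> * Q / \<delta>\<^sup>2"
    using order_trans[OF abs_ge_zero principal_part_osc[OF x \<delta>(1) \<delta>x R(2), of x]] R by (simp add: Q_def)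
  have "0 < Q" using R \<delta> by (simp add: Q_def)
  then have \<kappa>0: "0 \<le> \<kappa>" using \<kappa>0 \<delta> by (simp add: zero_le_mult_iff zero_le_divide_iff)
  \<comment> \<open>Enlarging the ball by \<open>N\<close> costs \<open>N powr ap\<close>, while
    \<open>difference_bound\<close> gains \<open>1 / N\<close>; the net factor of \<open>S\<close>
    is \<open>N powr (ap - 1)\<close>, small for large \<open>N\<close> once
    \<open>ap < 1\<close>.\<close>
  have "Q = N powr \<alpha> x * q"
    using N r \<delta> by (simp add: Q_def q_def R_def powr_mult powr_divide)
  also have "\<dots> \<le> N powr ap * q"
    using N ap by (intro mult_right_mono powr_mono) (auto simp: q_def)
  finally have QN: "Q \<le> N powr ap * q" .
  have "Q / \<delta>\<^sup>2 * (16 * (1 + n * \<Lambda> / l) / N * S + N * \<kappa> / (2 * l * \<epsilon>\<^sup>2))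
     \<le> (N powr ap * q) / \<delta>\<^sup>2 * (16 * (1 + n * \<Lambda> / l) / N * S + N * \<kappa> / (2 * l * \<epsilon>\<^sup>2))"
    using QN N l n0 \<Lambda> S \<kappa>0 by (intro mult_right_mono divide_right_mono) auto
  also have "\<dots> = q / \<delta>\<^sup>2 * (16 * (1 + n * \<Lambda> / l) * N powr (ap - 1) * S + N powr (1 + ap) * \<kappa> / (2 * l * \<epsilon>\<^sup>2))"
  proof -
    have "N powr (ap - 1) = N powr ap / N" "N powr (1 + ap) = N powr ap * N"
      using N by (simp_all add: powr_diff powr_add)
    moreover define g where "g = 1 + n * \<Lambda> / l"
    ultimately show ?thesis unfolding g_def[symmetric] by (simp add: algebra_simps)
  qed
  finally have 1: "\<bar>w x - w y\<bar> / s\<^sup>2 \<le> q / \<delta>\<^sup>2 *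
      (16 * (1 + n * \<Lambda> / l) * N powr (ap - 1) * S + N powr (1 + ap) * \<kappa> / (2 * l * \<epsilon>\<^sup>2))"
    using w_diff by linarith
  \<comment> \<open>As \<open>2 * \<epsilon>\<close> is below \<open>1\<close>, its exponent may be
    lowered to \<open>am\<close>; the power of \<open>r / \<delta>\<close> must keep the exponent
    \<open>\<alpha> p\<close>.\<close>
  have step: "\<bar>double_diff i j s u p / s\<^sup>2 - D [i, j] u p\<bar> \<le> S * ((2 * \<epsilon>) powr am * (r / \<delta>) powr \<alpha> p) / \<delta>\<^sup>2"
    if p: "p \<in> \<Omega>" "2 * \<delta> \<le> bdist \<Omega> p" for p
  proof -
    have "\<bar>double_diff i j s u p / s\<^sup>2 - D [i, j] u p\<bar> \<le> S * (2 * s / \<delta>) powr \<alpha> p / \<delta>\<^sup>2"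
      by (rule double_diff_holder[OF p(1) \<delta>(1) p(2) s(1)]) (use s R r in auto)
    also have "(2 * s / \<delta>) powr \<alpha> p = (2 * \<epsilon>) powr \<alpha> p * (r / \<delta>) powr \<alpha> p"
      using \<epsilon> r \<delta> powr_mult[of "2 * \<epsilon>" "r / \<delta>" "\<alpha> p"] by (simp add: s_def mult_ac)
    also have "S * ((2 * \<epsilon>) powr \<alpha> p * (r / \<delta>) powr \<alpha> p) / \<delta>\<^sup>2 \<le> S * ((2 * \<epsilon>) powr am * (r / \<delta>) powr \<alpha> p) / \<delta>\<^sup>2"
      using S \<epsilon> exponent[OF p(1)]
      by (intro divide_right_mono mult_left_mono mult_right_mono powr_mono') auto
    finally show ?thesis .
  qed
  have 2: "\<bar>double_diff i j s u x / s\<^sup>2 - D [i, j] u x\<bar> \<le> q / \<delta>\<^sup>2 * ((2 * \<epsilon>) powr am * S)"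
    using step[OF x \<delta>x] by (simp add: q_def mult_ac)
  have "S * ((2 * \<epsilon>) powr am * (r / \<delta>) powr \<alpha> y) / \<delta>\<^sup>2 \<le> S * ((2 * \<epsilon>) powr am * (E * q)) / \<delta>\<^sup>2"
    using E S by (intro divide_right_mono mult_left_mono) (auto simp: q_def r_def)
  then have 3: "\<bar>double_diff i j s u y / s\<^sup>2 - D [i, j] u y\<bar> \<le> q / \<delta>\<^sup>2 * (E * (2 * \<epsilon>) powr am * S)"
    using step[OF y \<delta>y] by (simp add: mult_ac)
  have "\<bar>w x - w y\<bar> / s\<^sup>2 = \<bar>(w x - w y) / s\<^sup>2\<bar>" by simp
  also have "(w x - w y) / s\<^sup>2 = double_diff i j s u x / s\<^sup>2 - double_diff i j s u y / s\<^sup>2"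
    by (simp add: w_def diff_divide_distrib)
  finally have "\<bar>double_diff i j s u x / s\<^sup>2 - double_diff i j s u y / s\<^sup>2\<bar> \<le> q / \<delta>\<^sup>2 *
      (16 * (1 + n * \<Lambda> / l) * N powr (ap - 1) * S + N powr (1 + ap) * \<kappa> / (2 * l * \<epsilon>\<^sup>2))"
    using 1 by simp
  then have "\<bar>D [i, j] u x - D [i, j] u y\<bar> \<le> q / \<delta>\<^sup>2 *
      (16 * (1 + n * \<Lambda> / l) * N powr (ap - 1) * S + N powr (1 + ap) * \<kappa> / (2 * l * \<epsilon>\<^sup>2))
      + q / \<delta>\<^sup>2 * ((2 * \<epsilon>) powr am * S) + q / \<delta>\<^sup>2 * (E * (2 * \<epsilon>) powr am * S)"
    using 2 3 by linarith
  then show ?thesis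
    by (simp add: q_def r_def distrib_left distrib_right)
qed

text \<open>Close pairs are handled by \<open>second_derivative_difference\<close> on scale half of
  \<open>bdist2 \<Omega> x y\<close>. For distant pairs the separation is comparable to the boundary
  distance, and the bound \<open>U2\<close> at both points suffices.\<close>

lemma holder_quotient_bound:
  assumes x: "x \<in> \<Omega>" and y: "y \<in> \<Omega>" and xy: "x \<noteq> y"
    and N: "4 \<le> N" and \<epsilon>: "0 < \<epsilon>" "\<epsilon> \<le> 1 / 4" and ap: "\<alpha> x \<le> ap"
    and M: "log_holder_bound \<Omega> \<alpha> M"
  shows "bdist2 \<Omega> x y powr (2 + \<alpha> x) * (\<bar>D [i, j] u x - D [i, j] u y\<bar> / norm (x - y) powr \<alpha> x)
    \<le> 8 * (16 * (1 + n * \<Lambda> / l) * N powr (ap - 1) * S + N powr (1 + ap) * \<kappa> / (2 * l * \<epsilon>\<^sup>2)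
        + (1 + exp (2 * M) * max 1 (diameter \<Omega>)) * (2 * \<epsilon>) powr am * S) + 4 * N * U2"
  (is "?lhs \<le> 8 * ?B + _")
proof -
  define d where "d = bdist2 \<Omega> x y"
  define r where "r = norm (x - y)"
  have r: "0 < r" using xy by (simp add: r_def)
  have d: "0 < d" and dx: "d \<le> bdist \<Omega> x" and dy: "d \<le> bdist \<Omega> y"
    using bdist_pos[OF open_\<Omega> bounded_\<Omega>] x y by (auto simp: d_def bdist2_def)
  have ax: "0 < \<alpha> x" "\<alpha> x \<le> 1" using alpha_pos exponent x by auto
  have lhs: "?lhs = d\<^sup>2 * (d / r) powr \<alpha> x * \<bar>D [i, j] u x - D [i, j] u y\<bar>"
    using d r by (simp add: d_def[symmetric] r_def[symmetric] powr_add powr_numeral powr_divide)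
  have \<kappa>0: "0 \<le> \<kappa>"
  proof -
    have "0 \<le> U0" "0 \<le> U1" "0 \<le> U2"
      using U0[OF x] U1[OF x] U2[OF x] bdist_pos[OF open_\<Omega> bounded_\<Omega> x]
      by (meson abs_ge_zero order_trans mult_nonneg_nonneg less_imp_le zero_le_power)+
    then show ?thesis using \<Lambda> F0 by (simp add: \<kappa>_def n_def)
  qed
  have U20: "0 \<le> U2"
    using U2[OF x] by (meson abs_ge_zero order_trans mult_nonneg_nonneg zero_le_power2)
  have B0: "0 \<le> ?B"
  proof -
    have "0 \<le> n" by (simp add: n_def)
    then show ?thesis using N l \<Lambda> S \<kappa>0 by (intro add_nonneg_nonneg mult_nonneg_nonneg divide_nonneg_nonneg) auto
  qed
  show ?thesis
  proof (cases "N * r \<le> d / 2")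
    case True
    \<comment> \<open>Half of \<open>d\<close> leaves the factor \<open>d / \<delta> = 2\<close>;
      with the exponent \<open>2 + \<alpha> x \<le> 3\<close> it gives the constant
      \<open>8\<close>.\<close>
    define \<delta> where "\<delta> = d / 2"
    have \<delta>: "0 < \<delta>" "2 * \<delta> \<le> bdist2 \<Omega> x y" using d by (simp_all add: \<delta>_def d_def)
    have "1 * r \<le> N * r" using N r by (intro mult_right_mono) auto
    then have r\<delta>: "r \<le> \<delta>" using True by (simp add: \<delta>_def)
    have "\<delta> \<le> diameter \<Omega>"
      using bdist_le_diameter[OF open_\<Omega> bounded_\<Omega> x] dx d by (simp add: \<delta>_def)
    moreover have "\<bar>\<alpha> x - \<alpha> y\<bar> \<le> 1" using exponent[OF x] exponent[OF y] am by linarith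
    moreover have "\<bar>ln r\<bar> * \<bar>\<alpha> x - \<alpha> y\<bar> \<le> M"
      using M x y xy unfolding log_holder_bound_def r_def by blast
    ultimately have E: "(r / \<delta>) powr \<alpha> y \<le> exp (2 * M) * max 1 (diameter \<Omega>) * (r / \<delta>) powr \<alpha> x"
      using powr_log_holder_compare[OF r r\<delta>] by blast
    have "?lhs \<le> d\<^sup>2 * (d / r) powr \<alpha> x * ((r / \<delta>) powr \<alpha> x / \<delta>\<^sup>2 * ?B)"
      unfolding lhs
      using second_derivative_difference[OF x y xy \<delta> N _ \<epsilon> ap E[unfolded r_def]] True
      by (intro mult_left_mono) (auto simp: r_def \<delta>_def)
    also have "\<dots> = (d / \<delta>)\<^sup>2 * ((d / r) powr \<alpha> x * (r / \<delta>) powr \<alpha> x) * ?B"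
      by (simp add: power_divide)
    also have "(d / r) powr \<alpha> x * (r / \<delta>) powr \<alpha> x = (d / \<delta>) powr \<alpha> x"
      using d r \<delta> by (subst powr_mult[symmetric]) auto
    also have "(d / \<delta>) = 2" using d by (simp add: \<delta>_def)
    also have "2\<^sup>2 * 2 powr \<alpha> x * ?B \<le> 8 * ?B"
    proof -
      have "2 powr \<alpha> x \<le> (2::real) powr 1" using ax by (intro powr_mono) auto
      then show ?thesis using B0 by (intro mult_right_mono) auto
    qed
    also have "\<dots> \<le> 8 * ?B + 4 * N * U2" using N U20 by simp
    finally show ?thesis .
  next
    case False
    then have "d / r \<le> 2 * N" using r by (simp add: field_simps)
    then have "(d / r) powr \<alpha> x \<le> (2 * N) powr \<alpha> x" using d r ax by (intro powr_mono2) auto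
    also have "\<dots> \<le> (2 * N) powr 1" using N ax by (intro powr_mono) auto
    finally have q: "(d / r) powr \<alpha> x \<le> 2 * N" using N by simp
    have Dz: "d\<^sup>2 * \<bar>D [i, j] u z\<bar> \<le> U2" if "z \<in> \<Omega>" "d \<le> bdist \<Omega> z" for z
    proof -
      have "d\<^sup>2 * \<bar>D [i, j] u z\<bar> \<le> (bdist \<Omega> z)\<^sup>2 * \<bar>D [i, j] u z\<bar>"
        using that d by (intro mult_right_mono power_mono) auto
      then show ?thesis using U2[OF that(1), of i j] by linarith
    qed
    have "d\<^sup>2 * \<bar>D [i, j] u x - D [i, j] u y\<bar> \<le> d\<^sup>2 * (\<bar>D [i, j] u x\<bar> + \<bar>D [i, j] u y\<bar>)"
      by (intro mult_left_mono) auto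
    also have "\<dots> \<le> 2 * U2" using Dz[OF x dx] Dz[OF y dy] by (simp add: distrib_left)
    finally have "(d / r) powr \<alpha> x * (d\<^sup>2 * \<bar>D [i, j] u x - D [i, j] u y\<bar>) \<le> (2 * N) * (2 * U2)"
      using N by (intro mult_mono[OF q]) auto
    then have "d\<^sup>2 * (d / r) powr \<alpha> x * \<bar>D [i, j] u x - D [i, j] u y\<bar> \<le> 4 * N * U2"
      by (simp add: mult_ac)
    moreover have "0 \<le> 8 * ?B" by (rule mult_nonneg_nonneg[OF _ B0]) simp
    ultimately show ?thesis unfolding lhs by (intro add_increasing)
  qed
qed

end

section \<open>Absorption\<close>

text \<open>The form with \<open>4 * t\<close> and \<open>t \<le> 1 / 4\<close> serves the choices
  of \<epsilon>, of \<eta> and of \<open>N = 1 / t\<close> alike.\<close>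

lemma small_powr_exists:
  fixes a K :: real
  assumes "0 < a" "0 < K"
  obtains t where "0 < t" "t \<le> 1 / 4" "(4 * t) powr a \<le> K"
proof
  define t where "t = min (1 / 4) (K powr (1 / a) / 4)"
  show "0 < t" "t \<le> 1 / 4" using assms by (auto simp: t_def)
  have "(4 * t) powr a \<le> (K powr (1 / a)) powr a"
    using assms \<open>0 < t\<close> by (intro powr_mono2) (auto simp: t_def)
  then show "(4 * t) powr a \<le> K" using assms by (simp add: powr_powr)
qed

text \<open>Isolates the arithmetic of the absorption. \<open>N\<close>, \<epsilon>, \<eta> and
  \<open>C\<close> are chosen before \<open>S\<close>, \<open>U0\<close> and \<open>F0\<close>, so
  the constant depends on the structural parameters alone.\<close>

definition absorbing_constant :: "real \<Rightarrow> real \<Rightarrow> real \<Rightarrow> real \<Rightarrow> real \<Rightarrow> real \<Rightarrow> real \<Rightarrow> bool" where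
  "absorbing_constant n \<Lambda> l am ap E C \<longleftrightarrow> 0 < C \<and>
     (\<exists>N \<epsilon> \<eta>. 4 \<le> N \<and> 0 < \<epsilon> \<and> \<epsilon> \<le> 1 / 4 \<and> 0 < \<eta> \<and> \<eta> \<le> 1 / 4 \<and>
       (\<forall>S U0 U1 U2 F0. 0 \<le> S \<longrightarrow> 0 \<le> U0 \<longrightarrow> 0 \<le> F0 \<longrightarrow>
          U2 = 4 * U0 / \<eta>\<^sup>2 + 4 * S * (4 * \<eta>) powr am \<longrightarrow> U1 = 4 * U0 + 2 * U2 \<longrightarrow>
          S \<le> 8 * (16 * (1 + n * \<Lambda> / l) * N powr (ap - 1) * S
                 + N powr (1 + ap) * (F0 + 2 * n\<^sup>2 * \<Lambda> * U2 + 2 * n * \<Lambda> * U1 + \<Lambda> * U0) / (2 * l * \<epsilon>\<^sup>2)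
                 + (1 + E) * (2 * \<epsilon>) powr am * S) + 4 * N * U2 \<longrightarrow>
          U0 + U1 + U2 + S \<le> C * (U0 + F0)))"

lemma absorbing_constant_pos: "absorbing_constant n \<Lambda> l am ap E C \<Longrightarrow> 0 < C"
  unfolding absorbing_constant_def by (elim conjE)

text \<open>First \<open>N\<close> and \<epsilon> make the two explicit coefficients of
  \<open>S\<close> at most \<open>1 / 8\<close> each; then \<eta>, depending on both, makes the part
  of \<open>S\<close> hidden in \<open>U2\<close> at most \<open>S / 4\<close>. Half of
  \<open>S\<close> survives on the left.\<close>

lemma absorbing_constant_exists:
  assumes am: "0 < am" and ap: "ap < 1" and l: "0 < l" and \<Lambda>: "0 \<le> \<Lambda>" and E: "0 \<le> E" and n: "0 \<le> n"
  shows "\<exists>C. absorbing_constant n \<Lambda> l am ap E C"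
proof -
  define k1 where "k1 = 128 * (1 + n * \<Lambda> / l)"
  have k1: "0 < k1" using l \<Lambda> n by (simp add: k1_def add_pos_nonneg)
  obtain t where t: "0 < t" "t \<le> 1 / 4" "(4 * t) powr (1 - ap) \<le> 1 / (8 * k1)"
    using small_powr_exists[of "1 - ap" "1 / (8 * k1)"] ap k1 by auto
  define N where "N = 1 / t"
  have N: "4 \<le> N" using t by (simp add: N_def field_simps)
  have "N powr (ap - 1) = t powr (1 - ap)"
    using t by (simp add: N_def powr_divide powr_diff field_simps)
  also have "\<dots> \<le> (4 * t) powr (1 - ap)" using t ap by (intro powr_mono2) auto
  also note t(3)
  finally have p1: "k1 * N powr (ap - 1) \<le> 1 / 8" using k1 by (simp add: field_simps)
  obtain \<epsilon> where \<epsilon>: "0 < \<epsilon>" "\<epsilon> \<le> 1 / 4" "(4 * \<epsilon>) powr am \<le> 1 / (64 * (1 + E))"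
    using small_powr_exists[of am "1 / (64 * (1 + E))"] am E by auto
  have "(2 * \<epsilon>) powr am \<le> (4 * \<epsilon>) powr am" using \<epsilon> am by (intro powr_mono2) auto
  also note \<epsilon>(3)
  finally have p3: "8 * (1 + E) * (2 * \<epsilon>) powr am \<le> 1 / 8" using E by (simp add: field_simps)
  define Q where "Q = 8 * N powr (1 + ap) / (2 * l * \<epsilon>\<^sup>2)"
  have Q: "0 \<le> Q" using l by (simp add: Q_def)
  \<comment> \<open>The coefficient of \<open>U2\<close> after substituting
    \<open>U1 = 4 * U0 + 2 * U2\<close>.\<close>
  define P where "P = Q * (2 * n\<^sup>2 * \<Lambda> + 4 * n * \<Lambda>) + 4 * N"
  have P: "0 < P" using Q n \<Lambda> N by (auto simp: P_def intro!: add_nonneg_pos)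
  obtain \<eta> where \<eta>: "0 < \<eta>" "\<eta> \<le> 1 / 4" "(4 * \<eta>) powr am \<le> 1 / (16 * P)"
    using small_powr_exists[of am "1 / (16 * P)"] am P by auto
  define C0 where "C0 = 2 * (Q + Q * (8 * n * \<Lambda> + \<Lambda>) + 4 * P / \<eta>\<^sup>2)"
  have C0: "0 \<le> C0" using Q P n \<Lambda> by (simp add: C0_def)
  \<comment> \<open>\<open>U0 + U1 + U2\<close> is \<open>5 * U0 + 3 * U2\<close>, and
    \<open>U2\<close> is at most \<open>4 * U0 / \<eta>\<^sup>2 + 4 * S\<close>; this leaves
    \<open>13\<close> copies of \<open>S\<close>.\<close>
  define C where "C = 5 + 12 / \<eta>\<^sup>2 + 13 * C0"
  have C: "0 < C" using C0 by (simp add: C_def add_pos_nonneg)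
  have "U0 + U1 + U2 + S \<le> C * (U0 + F0)"
    if S: "0 \<le> S" and U0: "0 \<le> U0" and F0: "0 \<le> F0"
      and U2: "U2 = 4 * U0 / \<eta>\<^sup>2 + 4 * S * (4 * \<eta>) powr am" and U1: "U1 = 4 * U0 + 2 * U2"
      and le: "S \<le> 8 * (16 * (1 + n * \<Lambda> / l) * N powr (ap - 1) * S
                 + N powr (1 + ap) * (F0 + 2 * n\<^sup>2 * \<Lambda> * U2 + 2 * n * \<Lambda> * U1 + \<Lambda> * U0) / (2 * l * \<epsilon>\<^sup>2)
                 + (1 + E) * (2 * \<epsilon>) powr am * S) + 4 * N * U2" for S U0 U1 U2 F0
  proof -
    define X where "X = F0 + 2 * n\<^sup>2 * \<Lambda> * U2 + 2 * n * \<Lambda> * U1 + \<Lambda> * U0"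
    have QX: "Q * X = 8 * (N powr (1 + ap) * X / (2 * l * \<epsilon>\<^sup>2))"
      by (simp add: Q_def)
    have k1S: "k1 * N powr (ap - 1) * S = 8 * (16 * (1 + n * \<Lambda> / l) * N powr (ap - 1) * S)"
      by (simp add: k1_def)
    have k3S: "8 * (1 + E) * (2 * \<epsilon>) powr am * S = 8 * ((1 + E) * (2 * \<epsilon>) powr am * S)"
      by simp
    have "S \<le> k1 * N powr (ap - 1) * S + Q * X + 8 * (1 + E) * (2 * \<epsilon>) powr am * S + 4 * N * U2"
      using le unfolding X_def[symmetric] k1S k3S QX by (simp only: distrib_left)
    moreover have "k1 * N powr (ap - 1) * S \<le> 1 / 8 * S" using p1 S by (rule mult_right_mono)
    moreover have "8 * (1 + E) * (2 * \<epsilon>) powr am * S \<le> 1 / 8 * S" using p3 S by (rule mult_right_mono)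
    moreover have "Q * X + 4 * N * U2
        = Q * F0 + Q * (8 * n * \<Lambda> + \<Lambda>) * U0 + P * U2"
      by (simp add: X_def U1 P_def algebra_simps)
    ultimately have 1: "S \<le> S / 4 + (Q * F0 + Q * (8 * n * \<Lambda> + \<Lambda>) * U0 + P * U2)" by linarith
    have "4 * P * (4 * \<eta>) powr am \<le> 4 * P * (1 / (16 * P))"
      using \<eta> P by (intro mult_left_mono) auto
    also have "\<dots> = 1 / 4" using P by simp
    finally have "4 * P * (4 * \<eta>) powr am * S \<le> 1 / 4 * S" using S by (rule mult_right_mono)
    moreover have "P * U2 = 4 * P / \<eta>\<^sup>2 * U0 + 4 * P * (4 * \<eta>) powr am * S"
      by (simp add: U2 algebra_simps)
    \<comment> \<open>Stated with variables in place of the products, so that only linear arithmetic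
      remains.\<close>
    moreover have "S \<le> S / 4 + (B + V) \<Longrightarrow> Y \<le> 1 / 4 * S \<Longrightarrow> V = Z + Y \<Longrightarrow> S \<le> 2 * (B + Z)" for B V Y Z
      by (simp add: field_simps)
    ultimately have "S \<le> 2 * (Q * F0 + Q * (8 * n * \<Lambda> + \<Lambda>) * U0 + 4 * P / \<eta>\<^sup>2 * U0)"
      using 1 by blast
    also have "\<dots> \<le> C0 * (U0 + F0)"
    proof -
      have "2 * (Q * F0 + c * U0 + w * U0) \<le> 2 * (Q + c + w) * (U0 + F0)" if "0 \<le> c" "0 \<le> w" for c w
      proof -
        have "0 \<le> Q * U0 + c * F0 + w * F0" using that Q U0 F0 by simp
        then show ?thesis by (simp add: algebra_simps)
      qed
      then show ?thesis unfolding C0_def by this (use Q P n \<Lambda> in simp_all)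
    qed
    finally have S': "S \<le> C0 * (U0 + F0)" .
    have "(4 * \<eta>) powr am \<le> 1" using \<eta> am by (intro powr_le1) auto
    then have "4 * S * (4 * \<eta>) powr am \<le> 4 * S" using S by (simp add: mult_left_le)
    then have "U0 + U1 + U2 + S \<le> 5 * U0 + 12 / \<eta>\<^sup>2 * U0 + 13 * S"
      by (simp add: U1 U2)
    also have "\<dots> \<le> 5 * (U0 + F0) + 12 / \<eta>\<^sup>2 * (U0 + F0) + 13 * (C0 * (U0 + F0))"
      using S' F0 by (intro add_mono mult_left_mono) auto
    also have "\<dots> = C * (U0 + F0)" by (simp add: C_def algebra_simps)
    finally show ?thesis .
  qed
  then show ?thesis
    unfolding absorbing_constant_def
    by (intro exI[of _ C] conjI exI[of _ N] exI[of _ \<epsilon>] exI[of _ \<eta>] allI impI C N \<epsilon>(1,2) \<eta>(1,2))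
qed

text \<open>By \<open>S_least\<close>, a bound for all Hoelder quotients also bounds
  \<open>S\<close>, although \<open>S\<close> occurs in it. Since \<open>S\<close> is a real number,
  it can be absorbed.\<close>

lemma (in elliptic_eq) interior_estimate:
  assumes C: "absorbing_constant (real CARD('n)) \<Lambda> l am ap (exp (2 * M) * max 1 (diameter \<Omega>)) C"
    and ap: "\<And>x. x \<in> \<Omega> \<Longrightarrow> \<alpha> x \<le> ap"
    and M: "log_holder_bound \<Omega> \<alpha> M" and ne: "\<Omega> \<noteq> {}"
    and S_least: "\<And>V. 0 \<le> V \<Longrightarrow> (\<And>x y i j. x \<in> \<Omega> \<Longrightarrow> y \<in> \<Omega> \<Longrightarrow> x \<noteq> y \<Longrightarrow>
      bdist2 \<Omega> x y powr (2 + \<alpha> x) * (\<bar>D [i, j] u x - D [i, j] u y\<bar> / norm (x - y) powr \<alpha> x) \<le> V) \<Longrightarrow> S \<le> V"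
  obtains U1 U2 where "\<And>x i. x \<in> \<Omega> \<Longrightarrow> bdist \<Omega> x * \<bar>D [i] u x\<bar> \<le> U1"
    and "\<And>x i j. x \<in> \<Omega> \<Longrightarrow> (bdist \<Omega> x)\<^sup>2 * \<bar>D [i, j] u x\<bar> \<le> U2"
    and "0 \<le> U1" "0 \<le> U2" "U0 + U1 + U2 + S \<le> C * (U0 + F0)"
proof -
  from C[unfolded absorbing_constant_def]
  obtain N \<epsilon> \<eta> where N: "4 \<le> N" and \<epsilon>: "0 < \<epsilon>" "\<epsilon> \<le> 1 / 4" and \<eta>: "0 < \<eta>" "\<eta> \<le> 1 / 4"
    and absorb: "\<forall>S U0 U1 U2 F0. 0 \<le> S \<longrightarrow> 0 \<le> U0 \<longrightarrow> 0 \<le> F0 \<longrightarrow>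
      U2 = 4 * U0 / \<eta>\<^sup>2 + 4 * S * (4 * \<eta>) powr am \<longrightarrow> U1 = 4 * U0 + 2 * U2 \<longrightarrow>
      S \<le> 8 * (16 * (1 + real CARD('n) * \<Lambda> / l) * N powr (ap - 1) * S
         + N powr (1 + ap) * (F0 + 2 * (real CARD('n))\<^sup>2 * \<Lambda> * U2 + 2 * real CARD('n) * \<Lambda> * U1 + \<Lambda> * U0) / (2 * l * \<epsilon>\<^sup>2)
         + (1 + exp (2 * M) * max 1 (diameter \<Omega>)) * (2 * \<epsilon>) powr am * S) + 4 * N * U2 \<longrightarrow>
      U0 + U1 + U2 + S \<le> C * (U0 + F0)"
    by (elim conjE exE) (rule that)
  \<comment> \<open>The interpolation bounds for the \<eta> that comes with the absorbing
    constant.\<close>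
  define U2 where "U2 = 4 * U0 / \<eta>\<^sup>2 + 4 * S * (4 * \<eta>) powr am"
  define U1 where "U1 = 4 * U0 + 2 * U2"
  have U2: "(bdist \<Omega> x)\<^sup>2 * \<bar>D [i, j] u x\<bar> \<le> U2" if "x \<in> \<Omega>" for x i j
    unfolding U2_def by (rule interpolation_2[OF that \<eta>])
  have U1: "bdist \<Omega> x * \<bar>D [i] u x\<bar> \<le> U1" if "x \<in> \<Omega>" for x i
    unfolding U1_def by (rule interpolation_1[OF that U2])
  interpret elliptic_C2 \<Omega> \<alpha> u S U0 am a b c f \<Lambda> l F0 U1 U2
    by unfold_locales (fact U1 U2)+
  obtain x0 where x0: "x0 \<in> \<Omega>" using ne by blast
  have U0': "0 \<le> U0" using order_trans[OF abs_ge_zero U0[OF x0]] .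
  have U2': "0 \<le> U2" using U0' S by (simp add: U2_def)
  have U1': "0 \<le> U1" using U0' U2' by (simp add: U1_def)
  have "S \<le> 8 * (16 * (1 + n * \<Lambda> / l) * N powr (ap - 1) * S + N powr (1 + ap) * \<kappa> / (2 * l * \<epsilon>\<^sup>2)
        + (1 + exp (2 * M) * max 1 (diameter \<Omega>)) * (2 * \<epsilon>) powr am * S) + 4 * N * U2"
  proof (rule S_least)
    show "0 \<le> 8 * (16 * (1 + n * \<Lambda> / l) * N powr (ap - 1) * S + N powr (1 + ap) * \<kappa> / (2 * l * \<epsilon>\<^sup>2)
        + (1 + exp (2 * M) * max 1 (diameter \<Omega>)) * (2 * \<epsilon>) powr am * S) + 4 * N * U2"
    proof -
      have "0 \<le> n" by (simp add: n_def)
      moreover from this have "0 \<le> \<kappa>" using \<Lambda> F0 U0' U1' U2' by (simp add: \<kappa>_def)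
      ultimately show ?thesis using N l \<Lambda> S U2'
        by (intro add_nonneg_nonneg mult_nonneg_nonneg divide_nonneg_nonneg) auto
    qed
  qed (rule holder_quotient_bound[OF _ _ _ N \<epsilon> ap M])
  then have "U0 + U1 + U2 + S \<le> C * (U0 + F0)"
    unfolding n_def \<kappa>_def by (rule absorb[rule_format, OF S U0' F0 U2_def U1_def])
  then show thesis using that U1 U2 U1' U2' by blast
qed

section \<open>From extended-real norms to real bounds\<close>

lemma weighted_norm_bounds:
  assumes "weighted_norm s \<alpha> \<Omega> f \<le> ennreal K" "0 \<le> K"
  shows "x \<in> \<Omega> \<Longrightarrow> bdist \<Omega> x powr s * \<bar>f x\<bar> \<le> K"
    and "x \<in> \<Omega> \<Longrightarrow> y \<in> \<Omega> \<Longrightarrow> x \<noteq> y \<Longrightarrow>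
      bdist2 \<Omega> x y powr (s + \<alpha> x) * (\<bar>f x - f y\<bar> / norm (x - y) powr \<alpha> x) \<le> K"
proof -
  let ?sup = "SUP x\<in>\<Omega>. ennreal (bdist \<Omega> x powr s * \<bar>f x\<bar>)"
  let ?hol = "SUP x\<in>\<Omega>. SUP y\<in>\<Omega> - {x}.
        ennreal (bdist2 \<Omega> x y powr (s + \<alpha> x) * (\<bar>f x - f y\<bar> / norm (x - y) powr \<alpha> x))"
  have "?sup \<le> ?sup + ?hol" "?hol \<le> ?sup + ?hol" by simp_all
  then have le: "?sup \<le> ennreal K" "?hol \<le> ennreal K"
    using assms order_trans unfolding weighted_norm_def by blast+
  show "bdist \<Omega> x powr s * \<bar>f x\<bar> \<le> K" if "x \<in> \<Omega>"
  proof -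
    have "ennreal (bdist \<Omega> x powr s * \<bar>f x\<bar>) \<le> ?sup"
      using that by (intro SUP_upper2[of x]) auto
    then show ?thesis using le(1) assms(2) order_trans ennreal_le_iff by blast
  qed
  show "bdist2 \<Omega> x y powr (s + \<alpha> x) * (\<bar>f x - f y\<bar> / norm (x - y) powr \<alpha> x) \<le> K"
    if "x \<in> \<Omega>" "y \<in> \<Omega>" "x \<noteq> y"
  proof -
    have "ennreal (bdist2 \<Omega> x y powr (s + \<alpha> x) * (\<bar>f x - f y\<bar> / norm (x - y) powr \<alpha> x)) \<le> ?hol"
      using that by (intro SUP_upper2[of x] SUP_upper2[of y]) auto
    then show ?thesis using le(2) assms(2) order_trans ennreal_le_iff by blast
  qed
qed

lemma int_holder_seminorm_upper:
  assumes "x \<in> \<Omega>" "y \<in> \<Omega>" "x \<noteq> y" "length \<beta> = k"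
  shows "ennreal (bdist2 \<Omega> x y powr (real k + \<alpha> x) * (\<bar>D \<beta> u x - D \<beta> u y\<bar> / norm (x - y) powr \<alpha> x))
    \<le> int_holder_seminorm k \<alpha> \<Omega> u"
  unfolding int_holder_seminorm_def using assms
  by (intro SUP_upper2[of x] SUP_upper2[of y] SUP_upper2[of \<beta>]) auto

lemma holder_seminorm_upper:
  assumes "x \<in> \<Omega>" "y \<in> \<Omega>" "x \<noteq> y" "length \<beta> = k"
  shows "ennreal (\<bar>D \<beta> u x - D \<beta> u y\<bar> / norm (x - y) powr \<alpha> x) \<le> holder_seminorm k \<alpha> \<Omega> u"
  unfolding holder_seminorm_def using assms
  by (intro SUP_upper2[of x] SUP_upper2[of y] SUP_upper2[of \<beta>]) auto

text \<open>Supplies the finiteness of \<open>S\<close> that absorption depends on. The weights are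
  at most a power of the diameter, and \<open>max 1\<close> allows the exponent to be raised to
  \<open>real k + 1\<close>.\<close>

lemma int_holder_seminorm_finite:
  assumes \<Omega>: "open \<Omega>" "bounded \<Omega>" and \<alpha>: "\<And>x. x \<in> \<Omega> \<Longrightarrow> 0 \<le> \<alpha> x \<and> \<alpha> x \<le> 1"
    and fin: "holder_seminorm k \<alpha> \<Omega> u < \<infinity>"
  shows "int_holder_seminorm k \<alpha> \<Omega> u < \<infinity>"
proof -
  define K where "K = max 1 (diameter \<Omega>) powr (real k + 1)"
  have "ennreal (bdist2 \<Omega> x y powr (real k + \<alpha> x) * (\<bar>D \<beta> u x - D \<beta> u y\<bar> / norm (x - y) powr \<alpha> x))
      \<le> ennreal K * holder_seminorm k \<alpha> \<Omega> u"
    if "x \<in> \<Omega>" "y \<in> \<Omega> - {x}" "length \<beta> = k" for x y \<beta>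
  proof -
    have "bdist2 \<Omega> x y powr (real k + \<alpha> x) \<le> max 1 (diameter \<Omega>) powr (real k + \<alpha> x)"
      using that bdist_le_diameter[OF \<Omega>, of x] bdist_pos[OF \<Omega>, of x] bdist_pos[OF \<Omega>, of y] \<alpha>[of x]
      by (intro powr_mono2) (auto simp: bdist2_def)
    also have "\<dots> \<le> K" unfolding K_def using that \<alpha>[of x] by (intro powr_mono) auto
    finally have "ennreal (bdist2 \<Omega> x y powr (real k + \<alpha> x)) *
        ennreal (\<bar>D \<beta> u x - D \<beta> u y\<bar> / norm (x - y) powr \<alpha> x) \<le> ennreal K * holder_seminorm k \<alpha> \<Omega> u"
      using that by (intro mult_mono holder_seminorm_upper ennreal_leI) auto
    then show ?thesis by (subst ennreal_mult) auto
  qed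
  then have "int_holder_seminorm k \<alpha> \<Omega> u \<le> ennreal K * holder_seminorm k \<alpha> \<Omega> u"
    unfolding int_holder_seminorm_def by (intro SUP_least) auto
  also have "\<dots> < \<infinity>" using fin by (simp add: ennreal_mult_less_top)
  finally show ?thesis .
qed

text \<open>The infimum \<open>c_log\<close> need not be admissible itself, for instance when
  \<alpha> is constant. Any larger number is, and adding \<open>1\<close> keeps the dependence on
  \<open>c_log\<close> only.\<close>

lemma log_holder_bound_c_log:
  assumes "\<exists>M. log_holder_bound \<Omega> \<alpha> M"
  shows "log_holder_bound \<Omega> \<alpha> (c_log \<Omega> \<alpha> + 1)"
proof -
  have "Inf {M. log_holder_bound \<Omega> \<alpha> M} < c_log \<Omega> \<alpha> + 1" by (simp add: c_log_def)
  then obtain M where M: "log_holder_bound \<Omega> \<alpha> M" "M < c_log \<Omega> \<alpha> + 1"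
    using cInf_lessD[of "{M. log_holder_bound \<Omega> \<alpha> M}"] assms by auto
  show ?thesis
    using M unfolding log_holder_bound_def by (meson less_trans less_imp_le order_trans)
qed

lemma A_log_bounds:
  assumes "\<alpha> \<in> A_log \<Omega>" "x \<in> \<Omega>"
  shows "exp_inf \<Omega> \<alpha> \<le> \<alpha> x" "\<alpha> x \<le> exp_sup \<Omega> \<alpha>"
proof -
  have *: "\<forall>x\<in>\<Omega>. 0 < \<alpha> x \<and> \<alpha> x \<le> 1" using assms(1) by (simp add: A_log_def)
  have "bdd_below (\<alpha> ` \<Omega>)" using * by (intro bdd_belowI[of _ 0]) (auto simp: less_imp_le)
  moreover have "bdd_above (\<alpha> ` \<Omega>)" using * by (intro bdd_aboveI[of _ 1]) auto
  ultimately show "exp_inf \<Omega> \<alpha> \<le> \<alpha> x" "\<alpha> x \<le> exp_sup \<Omega> \<alpha>"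
    using assms(2) by (auto simp: exp_inf_def exp_sup_def intro: cINF_lower cSUP_upper)
qed

lemma C_norm_0_upper: "x \<in> \<Omega> \<Longrightarrow> ennreal \<bar>u x\<bar> \<le> C_norm 0 \<Omega> u"
  unfolding C_norm_def by (auto simp: D_simps intro!: SUP_upper2[of x])

lemma schauder_interior:
  fixes \<Omega> :: "(real^'n) set"
  assumes \<Omega>: "open \<Omega>" "bounded \<Omega>" and \<alpha>: "\<alpha> \<in> A_log \<Omega>" and u: "u \<in> C_holder 2 \<alpha> \<Omega>"
    and eq: "\<And>x. x \<in> \<Omega> \<Longrightarrow> elliptic_op a b c u x = f x"
    and l: "0 < l" and \<Lambda>: "0 < \<Lambda>"
    and ell: "\<And>x \<zeta>. x \<in> \<Omega> \<Longrightarrow> l * (norm \<zeta>)\<^sup>2 \<le> (\<Sum>i\<in>UNIV. \<Sum>j\<in>UNIV. a i j x * \<zeta> $ i * \<zeta> $ j)"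
    and a: "\<And>i j. weighted_norm 0 \<alpha> \<Omega> (a i j) \<le> ennreal \<Lambda>"
    and b: "\<And>i. weighted_norm 1 \<alpha> \<Omega> (b i) \<le> ennreal \<Lambda>"
    and c: "weighted_norm 2 \<alpha> \<Omega> c \<le> ennreal \<Lambda>"
    and C: "absorbing_constant (real CARD('n)) \<Lambda> l (exp_inf \<Omega> \<alpha>) (exp_sup \<Omega> \<alpha>)
      (exp (2 * (c_log \<Omega> \<alpha> + 1)) * max 1 (diameter \<Omega>)) C"
  shows "int_holder_norm 2 \<alpha> \<Omega> u \<le> ennreal C * (C_norm 0 \<Omega> u + weighted_norm 2 \<alpha> \<Omega> f)"
proof (cases "\<Omega> = {} \<or> C_norm 0 \<Omega> u + weighted_norm 2 \<alpha> \<Omega> f = \<infinity>")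
  \<comment> \<open>On the empty set the left side is \<open>0\<close>; if the right side has an
    infinite factor it is infinite, because \<open>C\<close> is positive. Otherwise all norms
    involved are real numbers.\<close>
  case True
  then show ?thesis
  proof
    assume "\<Omega> = {}"
    then show ?thesis
      by (simp add: int_holder_norm_def int_seminorm_def int_holder_seminorm_def bot_ennreal)
  next
    assume *: "C_norm 0 \<Omega> u + weighted_norm 2 \<alpha> \<Omega> f = \<infinity>"
    show ?thesis unfolding * using absorbing_constant_pos[OF C] by (simp add: ennreal_mult_top)
  qed
next
  case False
  define U0 where "U0 = enn2real (C_norm 0 \<Omega> u)"
  define F0 where "F0 = enn2real (weighted_norm 2 \<alpha> \<Omega> f)"
  define S where "S = enn2real (int_holder_seminorm 2 \<alpha> \<Omega> u)"
  have U0_eq: "C_norm 0 \<Omega> u = ennreal U0" and F0_eq: "weighted_norm 2 \<alpha> \<Omega> f = ennreal F0"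
    using False by (auto simp: U0_def F0_def less_top)
  have \<alpha>01: "0 < \<alpha> x \<and> \<alpha> x \<le> 1" if "x \<in> \<Omega>" for x
    using \<alpha> that by (simp add: A_log_def)
  have "int_holder_seminorm 2 \<alpha> \<Omega> u < \<infinity>"
  proof (rule int_holder_seminorm_finite[OF \<Omega>])
    show "holder_seminorm 2 \<alpha> \<Omega> u < \<infinity>" using u by (simp add: C_holder_def)
  qed (use \<alpha>01 in \<open>auto simp: less_imp_le\<close>)
  then have S_eq: "int_holder_seminorm 2 \<alpha> \<Omega> u = ennreal S" by (simp add: S_def)
  have nonneg: "0 \<le> U0" "0 \<le> F0" "0 \<le> S" by (simp_all add: U0_def F0_def S_def)
  have pos: "0 < bdist \<Omega> x" if "x \<in> \<Omega>" for x using bdist_pos[OF \<Omega> that] .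
  note A = weighted_norm_bounds[OF a less_imp_le[OF \<Lambda>]] and B = weighted_norm_bounds[OF b less_imp_le[OF \<Lambda>]]
    and Cc = weighted_norm_bounds[OF c less_imp_le[OF \<Lambda>]]
    and F = weighted_norm_bounds[OF eq_refl[OF F0_eq] nonneg(2)]
  interpret elliptic_eq \<Omega> \<alpha> u S U0 "exp_inf \<Omega> \<alpha>" a b c f \<Lambda> l F0
  proof
    show "\<bar>u x\<bar> \<le> U0" if "x \<in> \<Omega>" for x
      using C_norm_0_upper[OF that, of u] nonneg by (simp add: U0_eq)
    show "bdist2 \<Omega> x y powr (2 + \<alpha> x) * (\<bar>D [i, j] u x - D [i, j] u y\<bar> / norm (x - y) powr \<alpha> x) \<le> S"
      if "x \<in> \<Omega>" "y \<in> \<Omega>" "x \<noteq> y" for x y i j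
      using int_holder_seminorm_upper[OF that, of "[i, j]" 2 \<alpha> u] nonneg by (simp add: S_eq)
    show "\<bar>a i j x\<bar> \<le> \<Lambda>" if "x \<in> \<Omega>" for i j x
      using A(1)[OF that, of i j] pos[OF that] by simp
    show "bdist \<Omega> x * \<bar>b i x\<bar> \<le> \<Lambda>" if "x \<in> \<Omega>" for i x
      using B(1)[OF that, of i] pos[OF that] by simp
    show "(bdist \<Omega> x)\<^sup>2 * \<bar>c x\<bar> \<le> \<Lambda>" if "x \<in> \<Omega>" for x
      using Cc(1)[OF that] pos[OF that] by (simp add: powr_numeral)
    show "u \<in> C_open 2 \<Omega>" using u by (simp add: C_holder_def C_closure_def)
    show "0 < exp_inf \<Omega> \<alpha>" using \<alpha> by (simp add: A_log_def)
  qed (use \<Omega> \<alpha>01 A_log_bounds(1)[OF \<alpha>] nonneg l \<Lambda> eq ell A(2) B(2) Cc(2) F(2) in auto)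
  obtain U1 U2 where U1: "\<And>x i. x \<in> \<Omega> \<Longrightarrow> bdist \<Omega> x * \<bar>D [i] u x\<bar> \<le> U1"
    and U2: "\<And>x i j. x \<in> \<Omega> \<Longrightarrow> (bdist \<Omega> x)\<^sup>2 * \<bar>D [i, j] u x\<bar> \<le> U2"
    and U12: "0 \<le> U1" "0 \<le> U2" and bound: "U0 + U1 + U2 + S \<le> C * (U0 + F0)"
  proof (rule interior_estimate[OF C])
    show "log_holder_bound \<Omega> \<alpha> (c_log \<Omega> \<alpha> + 1)"
      using \<alpha> by (intro log_holder_bound_c_log) (simp add: A_log_def)
    \<comment> \<open>\<open>S\<close> is the value of the seminorm, a supremum, hence the least
      bound.\<close>
    show "S \<le> V" if "0 \<le> V" and V: "\<And>x y i j. x \<in> \<Omega> \<Longrightarrow> y \<in> \<Omega> \<Longrightarrow> x \<noteq> y \<Longrightarrow>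
      bdist2 \<Omega> x y powr (2 + \<alpha> x) * (\<bar>D [i, j] u x - D [i, j] u y\<bar> / norm (x - y) powr \<alpha> x) \<le> V" for V
    proof -
      have "int_holder_seminorm 2 \<alpha> \<Omega> u \<le> ennreal V"
        unfolding int_holder_seminorm_def
        by (intro SUP_least ennreal_leI) (use V in \<open>auto simp: length_Suc_conv numeral_2_eq_2\<close>)
      then show ?thesis using that(1) by (simp add: S_eq)
    qed
  qed (use A_log_bounds(2)[OF \<alpha>] False in auto)
  have s0: "int_seminorm 0 \<Omega> u \<le> ennreal U0"
    unfolding int_seminorm_def by (intro SUP_least ennreal_leI) (auto simp: D_simps U0)
  have s1: "int_seminorm 1 \<Omega> u \<le> ennreal U1"
    unfolding int_seminorm_def
    by (intro SUP_least ennreal_leI) (use U1 in \<open>auto simp: length_Suc_conv\<close>)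
  have s2: "int_seminorm 2 \<Omega> u \<le> ennreal U2"
    unfolding int_seminorm_def
    by (intro SUP_least ennreal_leI) (use U2 in \<open>auto simp: length_Suc_conv numeral_2_eq_2\<close>)
  have "int_holder_norm 2 \<alpha> \<Omega> u = int_seminorm 0 \<Omega> u + int_seminorm 1 \<Omega> u + int_seminorm 2 \<Omega> u + ennreal S"
    unfolding int_holder_norm_def S_eq by (simp add: numeral_2_eq_2 atMost_Suc add_ac)
  also have "\<dots> \<le> ennreal U0 + ennreal U1 + ennreal U2 + ennreal S"
    by (intro add_mono s0 s1 s2 order_refl)
  also have "\<dots> = ennreal (U0 + U1 + U2 + S)" using nonneg U12 by (simp add: ennreal_plus)
  also have "\<dots> \<le> ennreal (C * (U0 + F0))" by (rule ennreal_leI[OF bound])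
  also have "\<dots> = ennreal C * (C_norm 0 \<Omega> u + weighted_norm 2 \<alpha> \<Omega> f)"
    using absorbing_constant_pos[OF C] nonneg by (simp add: ennreal_mult U0_eq F0_eq ennreal_plus)
  finally show ?thesis .
qed

text \<open>The constant is a function quantified before the domain and all data; the dimension
  enters through the type \<open>'n\<close>. Its value is a chosen \<open>absorbing_constant\<close>
  for these parameters.\<close>

theorem theorem4p1:
  "\<exists>C :: real \<Rightarrow> real \<Rightarrow> real \<Rightarrow> real \<Rightarrow> real \<Rightarrow> real \<Rightarrow> real.
     \<forall>(\<Omega> :: (real^'n) set) (\<alpha> :: real^'n \<Rightarrow> real)
      (a :: 'n \<Rightarrow> 'n \<Rightarrow> real^'n \<Rightarrow> real) (b :: 'n \<Rightarrow> real^'n \<Rightarrow> real) (c :: real^'n \<Rightarrow> real)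
      (f :: real^'n \<Rightarrow> real) (u :: real^'n \<Rightarrow> real) (\<Lambda> :: real) (l :: real).
       open \<Omega> \<and> bounded \<Omega> \<and> \<alpha> \<in> A_log \<Omega> \<and>
       (\<forall>i j. a i j \<in> C_holder 0 \<alpha> \<Omega>) \<and> (\<forall>i. b i \<in> C_holder 0 \<alpha> \<Omega>) \<and>
       c \<in> C_holder 0 \<alpha> \<Omega> \<and> f \<in> C_holder 0 \<alpha> \<Omega> \<and> u \<in> C_holder 2 \<alpha> \<Omega> \<and>
       (\<forall>x\<in>\<Omega>. elliptic_op a b c u x = f x) \<and>
       l > 0 \<and> \<Lambda> > 0 \<and>
       (\<forall>x\<in>\<Omega>. \<forall>\<zeta> :: real^'n.
          (\<Sum>i\<in>UNIV. \<Sum>j\<in>UNIV. a i j x * \<zeta> $ i * \<zeta> $ j) \<ge> l * (norm \<zeta>)\<^sup>2) \<and>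
       (\<forall>i j. weighted_norm 0 \<alpha> \<Omega> (a i j) \<le> ennreal \<Lambda>) \<and>
       (\<forall>i. weighted_norm 1 \<alpha> \<Omega> (b i) \<le> ennreal \<Lambda>) \<and>
       weighted_norm 2 \<alpha> \<Omega> c \<le> ennreal \<Lambda>
       \<longrightarrow> int_holder_norm 2 \<alpha> \<Omega> u
             \<le> ennreal (C (diameter \<Omega>) (exp_inf \<Omega> \<alpha>) (exp_sup \<Omega> \<alpha>) (c_log \<Omega> \<alpha>) \<Lambda> l)
               * (C_norm 0 \<Omega> u + weighted_norm 2 \<alpha> \<Omega> f)"
proof (intro exI[of _ "\<lambda>\<delta> am ap M \<Lambda> l. SOME C.
    absorbing_constant (real CARD('n)) \<Lambda> l am ap (exp (2 * (M + 1)) * max 1 \<delta>) C"] allI impI,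
    elim conjE)
  fix \<Omega> :: "(real^'n) set" and \<alpha> f u :: "real^'n \<Rightarrow> real" and a b c and \<Lambda> l :: real
  assume *: "open \<Omega>" "bounded \<Omega>" "\<alpha> \<in> A_log \<Omega>" "u \<in> C_holder 2 \<alpha> \<Omega>"
    and eq: "\<forall>x\<in>\<Omega>. elliptic_op a b c u x = f x"
    and pos: "0 < l" "0 < \<Lambda>"
    and ell: "\<forall>x\<in>\<Omega>. \<forall>\<zeta> :: real^'n. l * (norm \<zeta>)\<^sup>2 \<le> (\<Sum>i\<in>UNIV. \<Sum>j\<in>UNIV. a i j x * \<zeta> $ i * \<zeta> $ j)"
    and a: "\<forall>i j. weighted_norm 0 \<alpha> \<Omega> (a i j) \<le> ennreal \<Lambda>"
    and b: "\<forall>i. weighted_norm 1 \<alpha> \<Omega> (b i) \<le> ennreal \<Lambda>"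
    and c: "weighted_norm 2 \<alpha> \<Omega> c \<le> ennreal \<Lambda>"
  \<comment> \<open>The choice is legitimate because membership in \<open>A_log\<close> gives
    \<open>0 < exp_inf \<Omega> \<alpha>\<close> and \<open>exp_sup \<Omega> \<alpha> < 1\<close>,
    as \<open>absorbing_constant_exists\<close> demands.\<close>
  show "int_holder_norm 2 \<alpha> \<Omega> u
    \<le> ennreal (SOME C. absorbing_constant (real CARD('n)) \<Lambda> l (exp_inf \<Omega> \<alpha>) (exp_sup \<Omega> \<alpha>)
        (exp (2 * (c_log \<Omega> \<alpha> + 1)) * max 1 (diameter \<Omega>)) C) * (C_norm 0 \<Omega> u + weighted_norm 2 \<alpha> \<Omega> f)"
  proof (rule schauder_interior[OF * _ pos _ _ _ c someI_ex[OF absorbing_constant_exists]])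
  qed (use eq ell a b pos *(3) in \<open>auto simp: A_log_def\<close>)
qed

end
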